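(* Let $n\ge 2k$ and let $\mathcal F\subset\binom{[n]}{k}$ be a nonempty intersecting family with $|\mathcal F|\ge 48\binom{n-3}{k-3}$. Then $\varrho(\mathcal F)>\frac12$.
   Context: A family $\mathcal F$ is intersecting if $F\cap F'\neq\emptyset$ for all $F,F'\in\mathcal F$. For $i\in[n]$, $\mathcal F(i)=\{F\setminus\{i\}: i\in F\in\mathcal F\}$, and $\varrho(\mathcal F)=\max_{i\in[n]}|\mathcal F(i)|/|\mathcal F|$. *)

theory Defs
  imports Complex_Main
begin

definition intersecting :: "nat set set \<Rightarrow> bool" where
  "intersecting F \<longleftrightarrow> (\<forall>A\<in>F. \<forall>B\<in>F. A \<inter> B \<noteq> {})"

definition link :: "nat set set \<Rightarrow> nat \<Rightarrow> nat set set" where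
  "link F i = {A - {i} | A. A \<in> F \<and> i \<in> A}"

definition rho :: "nat \<Rightarrow> nat set set \<Rightarrow> real" where
  "rho n F = Max ((\<lambda>i. real (card (link F i)) / real (card F)) ` {1..n})"

definition binom_int :: "int \<Rightarrow> int \<Rightarrow> nat" where
  "binom_int m j = (if j < 0 \<or> m < 0 then 0 else nat m choose nat j)"

end

theory Submission
  imports Defs
begin

text \<open>If every element of the ground set has degree at most \<open>|F|/2\<close>, shift \<open>F\<close> and look at the last
  family with this property. Either it is completely shifted, or for some pair \<open>i, j\<close> more than half
  of its members meet \<open>{i, j}\<close>. Links at disjoint traces are cross-intersecting, and the walk
  (reflection) bound for shifted families limits how large both of them can be, up to constants that do
  not depend on \<open>k\<close>. Families that are too large for such a bound are close to a star or to a 2-cover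
  (\<open>cross_common_star\<close>, \<open>cross_star_or_cover\<close>). Unlike the property of being shifted, this
  structure survives undoing a shift, and a large intersecting family close to a star, or to the
  triangle family of sets with two elements in a given triple, has an element of degree above
  \<open>|F|/2\<close>.\<close>

subsection \<open>Walks of shifted families\<close>

text \<open>A shift from \<open>j\<close> to \<open>i\<close> can raise the degree of
  \<open>i\<close>, so small degrees need not survive it; conclusions are instead carried backwards,
  from the shifted family to the original. A backward step loses a few multiples of the error term,
  and the number of shifts is not bounded. The losses do not add up because stars and covers repair
  themselves: many sets through \<open>y\<close> in one of two cross-intersecting families leave few
  sets missing \<open>y\<close> in the other, by a bound that does not refer to the earlier error.
  The error term is \<open>u = (n - 1) choose (k - 3)\<close>. With \<open>24 * u\<close> members, a
  pair met by more than half of them is met by more than \<open>12 * u\<close>, and losing a trace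
  of size \<open>4 * u\<close> still leaves a degree above the \<open>7 * u\<close> that
  \<open>large_degree_of_balanced\<close> asks for. The other factor 2 of 48 replaces
  \<open>u\<close> by \<open>(n - 3) choose (k - 3)\<close>. For large \<open>k\<close> and
  \<open>n\<close> near \<open>2 * k\<close> the quotient of these is close to 4, but there 48 times
  the smaller one exceeds \<open>n choose (k - 1)\<close>, an upper bound for every intersecting
  family.\<close>

definition ksets :: "nat set \<Rightarrow> nat \<Rightarrow> nat set set" where
  "ksets V a = {S. S \<subseteq> V \<and> card S = a}"

definition cross_intersecting :: "nat set set \<Rightarrow> nat set set \<Rightarrow> bool" where
  "cross_intersecting A B \<longleftrightarrow> (\<forall>S\<in>A. \<forall>T\<in>B. S \<inter> T \<noteq> {})"

definition shifted :: "nat set \<Rightarrow> nat set set \<Rightarrow> bool" where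
  "shifted V A \<longleftrightarrow>
     (\<forall>S\<in>A. \<forall>i\<in>V. \<forall>j\<in>S. i < j \<longrightarrow> i \<notin> S \<longrightarrow> insert i (S - {j}) \<in> A)"

text \<open>Read \<open>V\<close> in increasing order, stepping up at elements of \<open>S\<close> and down otherwise:
  \<open>climbs V e S\<close> says that this walk reaches height \<open>e\<close>.\<close>

definition climbs :: "nat set \<Rightarrow> nat \<Rightarrow> nat set \<Rightarrow> bool" where
  "climbs V e S \<longleftrightarrow> (\<exists>t. card (V \<inter> {..<t}) + e \<le> 2 * card (S \<inter> {..<t}))"

text \<open>The sum of the walks of \<open>S\<close> and \<open>T\<close> reaches height \<open>2 * c\<close>.\<close>

definition meet_early :: "nat set \<Rightarrow> nat \<Rightarrow> nat set \<Rightarrow> nat set \<Rightarrow> bool" where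
  "meet_early V c S T \<longleftrightarrow>
     (\<exists>t. card (V \<inter> {..<t}) + c \<le> card (S \<inter> {..<t}) + card (T \<inter> {..<t}))"

lemma finite_ksets [simp]: "finite V \<Longrightarrow> finite (ksets V a)"
  by (simp add: ksets_def)

lemma card_ksets: "finite V \<Longrightarrow> card (ksets V a) = card V choose a"
  by (simp add: ksets_def n_subsets)

lemma cross_intersecting_sym: "cross_intersecting A B \<Longrightarrow> cross_intersecting B A"
  by (auto simp: cross_intersecting_def Int_commute)

text \<open>Exchange argument: if the walks never have a positive sum, then below the least common
  element \<open>x\<close> some \<open>y\<close> lies in neither set, since \<open>x\<close> counts
  twice. Exchanging \<open>x\<close> for \<open>y\<close> stays in \<open>A\<close>, shrinks the
  intersection and creates no positive sum either, so it could go on until the intersection is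
  empty.\<close>

lemma meet_early_shifted:
  assumes "finite V" "shifted V A" "cross_intersecting A B"
    and "S \<in> A" "T \<in> B" "S \<subseteq> V" "T \<subseteq> V"
  shows "meet_early V 1 S T"
  using assms(4,6)
proof (induction "card (S \<inter> T)" arbitrary: S rule: less_induct)
  case less
  have fS: "finite S" and fT: "finite T"
    using less.prems assms finite_subset by blast+
  show ?case
  proof (rule ccontr)
    assume "\<not> ?thesis"
    then have small: "card (S \<inter> {..<t}) + card (T \<inter> {..<t}) \<le> card (V \<inter> {..<t})" for t
      unfolding meet_early_def not_ex not_le by (drule_tac x = t in spec) linarith
    have ne: "S \<inter> T \<noteq> {}"
      using assms less.prems by (auto simp: cross_intersecting_def)
    define x where "x = Min (S \<inter> T)"
    have x: "x \<in> S" "x \<in> T" and xmin: "\<And>z. z \<in> S \<Longrightarrow> z \<in> T \<Longrightarrow> x \<le> z"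
      using ne fS Min_in[of "S \<inter> T"] by (auto simp: x_def)
    have un: "card (S \<inter> {..<t}) + card (T \<inter> {..<t}) = card ((S \<union> T) \<inter> {..<t})" if "t \<le> x" for t
    proof -
      have "(S \<inter> {..<t}) \<inter> (T \<inter> {..<t}) = {}"
        using xmin that by fastforce
      then show ?thesis
        using fS fT by (simp add: card_Un_disjoint[symmetric] Int_Un_distrib2)
    qed
    have "\<exists>y\<in>V. y < x \<and> y \<notin> S \<union> T"
    proof (rule ccontr)
      assume "\<not> ?thesis"
      then have "V \<inter> {..<x} \<subseteq> (S \<union> T) \<inter> {..<x}" by auto
      then have "card (V \<inter> {..<x}) \<le> card (S \<inter> {..<x}) + card (T \<inter> {..<x})"
        using un[of x] fS fT by (simp add: card_mono)
      moreover have "{..<Suc x} = insert x {..<x}" by auto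
      then have "card (Z \<inter> {..<Suc x}) = Suc (card (Z \<inter> {..<x}))" if "x \<in> Z" "finite Z" for Z
        using that by (simp add: Int_insert_right)
      then have "card (S \<inter> {..<Suc x}) + card (T \<inter> {..<Suc x}) =
          Suc (Suc (card (S \<inter> {..<x}) + card (T \<inter> {..<x})))"
        "card (V \<inter> {..<Suc x}) = Suc (card (V \<inter> {..<x}))"
        using x fS fT assms(1) less.prems by auto
      ultimately show False using small[of "Suc x"] by linarith
    qed
    then obtain y where y: "y \<in> V" "y < x" "y \<notin> S" "y \<notin> T" by auto
    define S' where "S' = insert y (S - {x})"
    have S': "S' \<in> A" "S' \<subseteq> V"
      using assms(2) less.prems x y by (auto simp: shifted_def S'_def)
    have "S' \<inter> T \<subset> S \<inter> T"
      using x y by (auto simp: S'_def)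
    then have "card (S' \<inter> T) < card (S \<inter> T)"
      using fS by (simp add: psubset_card_mono)
    then have "meet_early V 1 S' T" using less.hyps S' by blast
    then obtain t where t: "card (V \<inter> {..<t}) < card (S' \<inter> {..<t}) + card (T \<inter> {..<t})"
      by (auto simp: meet_early_def Suc_le_eq)
    show False
    proof (cases "t \<le> y \<or> x < t")
      case True
      have "card (S' \<inter> {..<t}) = card (S \<inter> {..<t})"
      proof (cases "t \<le> y")
        case True
        then have "S' \<inter> {..<t} = S \<inter> {..<t}" using y by (auto simp: S'_def)
        then show ?thesis by simp
      next
        case False
        then have "S' \<inter> {..<t} = insert y (S \<inter> {..<t} - {x})" using y by (auto simp: S'_def)
        moreover have "x \<in> S \<inter> {..<t}" using False True x by auto
        ultimately show ?thesis using y fS by (simp add: card_Suc_Diff1 del: card_Diff_insert)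
      qed
      then show False using t small[of t] by linarith
    next
      \<comment> \<open>For \<open>y < t \<le> x\<close> the exchanged set gains an element, but
        below \<open>x\<close> the sets are disjoint and \<open>y\<close> was free, so both counts
        together still fit into \<open>V\<close>.\<close>
      case False
      have "S' \<inter> {..<t} \<subseteq> insert y (S \<inter> {..<t})" by (auto simp: S'_def)
      then have "card (S' \<inter> {..<t}) \<le> card (insert y (S \<inter> {..<t}))"
        using fS by (intro card_mono) auto
      then have "card (S' \<inter> {..<t}) \<le> Suc (card (S \<inter> {..<t}))"
        using y fS by simp
      moreover have "insert y ((S \<union> T) \<inter> {..<t}) \<subseteq> V \<inter> {..<t}"
        using False y less.prems assms by auto
      then have "card (insert y ((S \<union> T) \<inter> {..<t})) \<le> card (V \<inter> {..<t})"
        using assms(1) by (intro card_mono) auto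
      then have "Suc (card ((S \<union> T) \<inter> {..<t})) \<le> card (V \<inter> {..<t})"
        using y fS fT by simp
      ultimately show False using t un[of t] False by linarith
    qed
  qed
qed

lemma climbs_0 [simp]: "climbs V 0 S"
  by (auto simp: climbs_def intro: exI[of _ 0])

lemma climbs_mono: "climbs V e S \<Longrightarrow> e' \<le> e \<Longrightarrow> climbs V e' S"
  unfolding climbs_def by (erule exE, rule_tac x = t in exI, linarith)

lemma meet_early_imp_climbs:
  assumes "meet_early V c S T" "\<not> climbs V e T"
  shows "climbs V (2 * c + 1 - e) S"
proof -
  obtain t where "card (V \<inter> {..<t}) + c \<le> card (S \<inter> {..<t}) + card (T \<inter> {..<t})"
    using assms by (auto simp: meet_early_def)
  moreover have "2 * card (T \<inter> {..<t}) < card (V \<inter> {..<t}) + e"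
    using assms by (auto simp: climbs_def not_le)
  ultimately have "card (V \<inter> {..<t}) + (2 * c + 1 - e) \<le> 2 * card (S \<inter> {..<t}) \<or> 2 * c + 1 \<le> e"
    by linarith
  then show ?thesis
  proof
    assume "2 * c + 1 \<le> e" then show ?thesis by simp
  qed (auto simp: climbs_def)
qed

context
  fixes V :: "nat set" and v :: nat
  assumes fin: "finite V" and v: "v \<in> V" and least: "\<And>w. w \<in> V \<Longrightarrow> v \<le> w"
begin

lemma before_least: "S \<subseteq> V \<Longrightarrow> t \<le> v \<Longrightarrow> S \<inter> {..<t} = {}"
  using least by fastforce

lemma card_after_least:
  assumes "S \<subseteq> V" "v < t"
  shows "card (S \<inter> {..<t}) = of_bool (v \<in> S) + card ((S - {v}) \<inter> {..<t})"
proof (cases "v \<in> S")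
  case True
  have "S \<inter> {..<t} = insert v ((S - {v}) \<inter> {..<t})" using True assms by auto
  moreover have "finite S" using assms fin finite_subset by blast
  ultimately show ?thesis using True by simp
next
  case False
  then have "S - {v} = S" by auto
  with False show ?thesis by simp
qed

text \<open>The least element is the first step of both walks: a set containing it has earned one
  unit of the required sum, a set missing it owes one more. The positive target rules out prefixes
  that end before \<open>v\<close>.\<close>

lemma meet_early_remove_least:
  assumes "meet_early V (Suc c) S T" "S \<subseteq> V" "T \<subseteq> V"
  shows "meet_early (V - {v}) (Suc (Suc c) - of_bool (v \<in> S) - of_bool (v \<in> T)) (S - {v}) (T - {v})"
proof -
  obtain t where t: "card (V \<inter> {..<t}) + Suc c \<le> card (S \<inter> {..<t}) + card (T \<inter> {..<t})"
    using assms by (auto simp: meet_early_def)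
  have "v < t"
  proof (rule ccontr)
    assume "\<not> v < t"
    then show False using t assms by (simp add: before_least)
  qed
  then have "card ((V - {v}) \<inter> {..<t}) + (Suc (Suc c) - of_bool (v \<in> S) - of_bool (v \<in> T))
      \<le> card ((S - {v}) \<inter> {..<t}) + card ((T - {v}) \<inter> {..<t})"
    using t card_after_least[of S t] card_after_least[of T t] card_after_least[of V t] v assms
    by (auto split: if_splits)
  then show ?thesis by (auto simp: meet_early_def)
qed

lemma climbs_least_notin:
  assumes "S \<subseteq> V" "v \<notin> S"
  shows "climbs V (Suc e) S \<longleftrightarrow> climbs (V - {v}) (Suc (Suc e)) S"
proof -
  have "card (V \<inter> {..<t}) + Suc e \<le> 2 * card (S \<inter> {..<t}) \<longleftrightarrow>
      card ((V - {v}) \<inter> {..<t}) + Suc (Suc e) \<le> 2 * card (S \<inter> {..<t})" for t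
  proof (cases "t \<le> v")
    case True
    then show ?thesis using assms by (simp add: before_least)
  next
    case False
    then show ?thesis
      using card_after_least[of S t] card_after_least[of V t] v assms by auto
  qed
  then show ?thesis by (simp add: climbs_def)
qed

lemma climbs_least_in:
  assumes "S \<subseteq> V" "v \<in> S"
  shows "climbs V (Suc e) S \<longleftrightarrow> climbs (V - {v}) e (S - {v})"
proof -
  have eq: "card (V \<inter> {..<t}) + Suc e \<le> 2 * card (S \<inter> {..<t}) \<longleftrightarrow>
      card ((V - {v}) \<inter> {..<t}) + e \<le> 2 * card ((S - {v}) \<inter> {..<t})" if "v < t" for t
    using card_after_least[of S t] card_after_least[of V t] v assms that by auto
  show ?thesis
  proof
    assume "climbs V (Suc e) S"
    then obtain t where t: "card (V \<inter> {..<t}) + Suc e \<le> 2 * card (S \<inter> {..<t})"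
      by (auto simp: climbs_def)
    then have "v < t" using before_least[of S t] assms by (cases "v < t") auto
    then show "climbs (V - {v}) e (S - {v})" using t eq by (auto simp: climbs_def)
  next
    assume "climbs (V - {v}) e (S - {v})"
    then obtain t where t: "card ((V - {v}) \<inter> {..<t}) + e \<le> 2 * card ((S - {v}) \<inter> {..<t})"
      by (auto simp: climbs_def)
    show "climbs V (Suc e) S"
    proof (cases "v < t")
      case True
      then show ?thesis using t eq by (auto simp: climbs_def)
    next
      case False
      then have "(S - {v}) \<inter> {..<t} = {}" "(V - {v}) \<inter> {..<t} = {}"
        using before_least[of "S - {v}" t] before_least[of "V - {v}" t] assms by auto
      \<comment> \<open>The witness for target 0 may end before \<open>v\<close>, where the walk in
        \<open>V\<close> has not climbed yet; the prefix ending with \<open>v\<close> serves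
        instead.\<close>
      then have "e = 0" using t by simp
      moreover have "(S - {v}) \<inter> {..<Suc v} = {}" "(V - {v}) \<inter> {..<Suc v} = {}"
        using least assms(1) by fastforce+
      ultimately show ?thesis using eq[of "Suc v"] by (auto simp: climbs_def intro!: exI[of _ "Suc v"])
    qed
  qed
qed

end

lemma climbs_le_card:
  assumes "finite V" "S \<subseteq> V" "climbs V e S"
  shows "e \<le> card S"
proof -
  obtain t where t: "card (V \<inter> {..<t}) + e \<le> 2 * card (S \<inter> {..<t})"
    using assms by (auto simp: climbs_def)
  have "card (S \<inter> {..<t}) \<le> card (V \<inter> {..<t})" "card (S \<inter> {..<t}) \<le> card S"
    using assms finite_subset[OF assms(2,1)] by (auto intro!: card_mono)
  with t show ?thesis by linarith
qed

text \<open>The first element moves the walk by one step in either direction, so the bound satisfies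
  Pascal's recursion; this is the reflection principle.\<close>

lemma card_climbs_le:
  "finite V \<Longrightarrow> card {S \<in> ksets V a. climbs V e S} \<le> card V choose (a - e)"
proof (induction "card V" arbitrary: V a e)
  case 0
  then have "V = {}" by simp
  show ?case
  proof (cases "a = 0 \<and> e = 0")
    case True
    have "card {S \<in> ksets V a. climbs V e S} \<le> card (ksets V a)"
      by (rule card_mono) (auto simp: 0)
    then show ?thesis using True 0 by (simp add: card_ksets)
  next
    case False
    then have "{S \<in> ksets V a. climbs V e S} = {}"
      using \<open>V = {}\<close> by (auto simp: ksets_def climbs_def)
    then show ?thesis by (simp only: card.empty le0)
  qed
next
  case (Suc m)
  show ?case
  proof (cases e)
    case 0
    have "card {S \<in> ksets V a. climbs V e S} \<le> card (ksets V a)"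
      by (rule card_mono) (auto simp: Suc)
    then show ?thesis using 0 Suc by (simp add: card_ksets)
  next
    case e: (Suc d)
    define v where "v = Min V"
    have "V \<noteq> {}" using Suc by auto
    then have v: "v \<in> V" and least: "\<And>w. w \<in> V \<Longrightarrow> v \<le> w"
      using Suc by (auto simp: v_def)
    define W where "W = V - {v}"
    have W: "card W = m" "finite W" using Suc v by (auto simp: W_def)
    let ?I = "{S \<in> ksets V a. climbs V e S}"
    let ?X = "{S \<in> ksets W (a - 1). climbs W d S}" and ?Y = "{S \<in> ksets W a. climbs W (Suc e) S}"
    show ?thesis
    proof (cases "a < e")
      case True
      then have "?I = {}"
        unfolding ksets_def using climbs_le_card[OF Suc.prems] leD by blast
      then show ?thesis by (metis card.empty le0)
    next
      case False
      have "?I \<subseteq> insert v ` ?X \<union> ?Y"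
      proof
        fix S assume S: "S \<in> ?I"
        then have SV: "S \<subseteq> V" and c: "card S = a" "climbs V (Suc d) S" by (auto simp: ksets_def e)
        have fS: "finite S" using SV Suc finite_subset by blast
        show "S \<in> insert v ` ?X \<union> ?Y"
        proof (cases "v \<in> S")
          case True
          then have "S - {v} \<in> ?X" "S = insert v (S - {v})"
            using climbs_least_in[OF Suc.prems v least SV True, of d] c SV fS
            by (auto simp: ksets_def W_def)
          then show ?thesis by blast
        next
          case False
          then have "S \<in> ?Y"
            using climbs_least_notin[OF Suc.prems v least SV False, of d] c SV
            by (auto simp: ksets_def W_def e)
          then show ?thesis by blast
        qed
      qed
      then have "card ?I \<le> card (insert v ` ?X \<union> ?Y)"
        using W by (intro card_mono) auto
      also have "\<dots> \<le> card (insert v ` ?X) + card ?Y"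
        by (rule card_Un_le)
      finally have le: "card ?I \<le> card (insert v ` ?X) + card ?Y" .
      have "card (insert v ` ?X) \<le> card ?X"
        using W by (intro card_image_le) simp
      also have "card ?X \<le> m choose (a - e)"
        using Suc.hyps(1)[of W "a - 1" d] W e by simp
      finally have X: "card (insert v ` ?X) \<le> m choose (a - e)" .
      show ?thesis
      proof (cases "a = e")
        \<comment> \<open>Truncated subtraction would give \<open>m choose 0\<close> for both parts,
          hence 2 instead of 1; but no set of size \<open>a = e\<close> climbs to
          \<open>Suc e\<close>.\<close>
        case True
        then have "?Y = {}"
          unfolding ksets_def using climbs_le_card[OF W(2)] Suc_n_not_le_n by blast
        then have "card ?Y = 0" by (simp only: card.empty)
        then show ?thesis using le X True by simp
      next
        case False
        with \<open>\<not> a < e\<close> obtain r where r: "a - e = Suc r" "a - Suc e = r"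
          by (metis Suc_diff_Suc linorder_neqE_nat)
        have "card ?Y \<le> m choose r"
          using Suc.hyps(1)[of W a "Suc e"] W r by simp
        then have "card ?I \<le> (m choose r) + (m choose Suc r)" using le X r by simp
        also have "\<dots> = card V choose (a - e)"
          by (simp only: Suc.hyps(2)[symmetric] r binomial_Suc_Suc)
        finally show ?thesis .
      qed
    qed
  qed
qed

lemma card_all_climb_le:
  assumes "finite V" "A \<subseteq> ksets V a" "\<And>S. S \<in> A \<Longrightarrow> climbs V e S"
  shows "card A \<le> card V choose (a - e)"
proof -
  have "card A \<le> card {S \<in> ksets V a. climbs V e S}"
    using assms by (intro card_mono) auto
  then show ?thesis using card_climbs_le[OF assms(1)] order_trans by blast
qed

subsection \<open>Traces\<close>

definition sect :: "nat set \<Rightarrow> nat set \<Rightarrow> nat set set \<Rightarrow> nat set set" where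
  "sect P Q A = {S \<in> A. P \<subseteq> S \<and> S \<inter> Q = {}}"

text \<open>\<open>sect\<close> keeps members whole, so that counts split additively and can be
  compared under shifts; deleting \<open>P\<close> yields a uniform family on a smaller ground set,
  to which the size bounds apply.\<close>

definition restr :: "nat set \<Rightarrow> nat set \<Rightarrow> nat set set \<Rightarrow> nat set set" where
  "restr P Q A = (\<lambda>S. S - P) ` sect P Q A"

lemma card_restr: "card (restr P Q A) = card (sect P Q A)"
  unfolding restr_def by (rule card_image) (auto simp: inj_on_def sect_def)

lemma restr_subset_ksets:
  assumes "finite V" "A \<subseteq> ksets V a"
  shows "restr P Q A \<subseteq> ksets (V - (P \<union> Q)) (a - card P)"
proof -
  have "card (S - P) = card S - card P" if "S \<in> A" "P \<subseteq> S" for S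
  proof -
    have "S \<subseteq> V" using that assms by (auto simp: ksets_def)
    then have "finite P" using that assms(1) by (meson finite_subset)
    then show ?thesis using that by (intro card_Diff_subset)
  qed
  then show ?thesis
    using assms by (force simp: restr_def sect_def ksets_def)
qed

lemma cross_intersecting_restr:
  assumes "cross_intersecting A B"
  shows "cross_intersecting (restr P Q A) (restr Q P B)"
proof -
  have "(S - P) \<inter> (T - Q) = S \<inter> T" if "S \<inter> Q = {}" "T \<inter> P = {}" for S T
    using that by auto
  then show ?thesis
    using assms by (auto simp: cross_intersecting_def restr_def sect_def)
qed

lemma card_le_choose:
  assumes "finite V" "A \<subseteq> ksets V a"
  shows "card A \<le> card V choose a"
  using card_mono[OF finite_ksets assms(2)] assms(1) by (simp add: card_ksets)

lemma card_sect_le: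
  assumes "finite V" "A \<subseteq> ksets V a"
  shows "card (sect P Q A) \<le> card (V - (P \<union> Q)) choose (a - card P)"
  using card_le_choose[OF _ restr_subset_ksets[OF assms]] assms(1) by (simp add: card_restr)

lemma card_sect_climbs_le:
  assumes "finite V" "A \<subseteq> ksets V a"
    and "\<And>S. S \<in> sect P Q A \<Longrightarrow> climbs (V - (P \<union> Q)) e (S - P)"
  shows "card (sect P Q A) \<le> card (V - (P \<union> Q)) choose (a - card P - e)"
  using card_all_climb_le[OF _ restr_subset_ksets[OF assms(1,2)], of P Q e] assms(1,3)
  by (auto simp: card_restr) (auto simp: restr_def)

lemma card_sect_split:
  assumes "finite A"
  shows "card (sect P Q A) = card (sect (insert x P) Q A) + card (sect P (insert x Q) A)"
proof -
  have "sect P Q A = sect (insert x P) Q A \<union> sect P (insert x Q) A"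
    "sect (insert x P) Q A \<inter> sect P (insert x Q) A = {}"
    by (auto simp: sect_def)
  moreover have "finite (sect P Q A)" for P Q using assms by (simp add: sect_def)
  ultimately show ?thesis by (simp add: card_Un_disjoint)
qed

lemma sect_empty [simp]: "sect {} {} A = A"
  by (simp add: sect_def)

lemma sect_mono: "P' \<subseteq> P \<Longrightarrow> Q' \<subseteq> Q \<Longrightarrow> sect P Q A \<subseteq> sect P' Q' A"
  by (auto simp: sect_def)

lemma card_sect_mono: "finite A \<Longrightarrow> P' \<subseteq> P \<Longrightarrow> Q' \<subseteq> Q \<Longrightarrow> card (sect P Q A) \<le> card (sect P' Q' A)"
  by (rule card_mono[OF _ sect_mono]) (auto simp: sect_def)

subsection \<open>Shifting\<close>

text \<open>The classical compression, as a map on members: it is injective on \<open>A\<close>, so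
  counts in the shifted family are counts of preimages.\<close>

definition shift_set :: "nat \<Rightarrow> nat \<Rightarrow> nat set set \<Rightarrow> nat set \<Rightarrow> nat set" where
  "shift_set i j A S =
     (if j \<in> S \<and> i \<notin> S \<and> insert i (S - {j}) \<notin> A then insert i (S - {j}) else S)"

definition shift :: "nat \<Rightarrow> nat \<Rightarrow> nat set set \<Rightarrow> nat set set" where
  "shift i j A = shift_set i j A ` A"

lemma inj_on_shift_set: "inj_on (shift_set i j A) A"
proof (rule inj_onI)
  fix S T assume S: "S \<in> A" and T: "T \<in> A" and eq: "shift_set i j A S = shift_set i j A T"
  have "S = insert j (insert i (S - {j}) - {i})" if "j \<in> S" "i \<notin> S" for S using that by auto
  then show "S = T"
    using S T eq unfolding shift_set_def by (metis (no_types, lifting))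
qed

lemma card_shift_filter: "card {S \<in> shift i j A. R S} = card {S \<in> A. R (shift_set i j A S)}"
proof -
  have "{S \<in> shift i j A. R S} = shift_set i j A ` {S \<in> A. R (shift_set i j A S)}"
    by (auto simp: shift_def)
  then show ?thesis
    using inj_on_shift_set by (simp add: card_image inj_on_subset[OF inj_on_shift_set])
qed

lemma card_shift [simp]: "card (shift i j A) = card A"
  by (simp add: shift_def card_image inj_on_shift_set)

lemma card_le_shift_filter:
  assumes "finite A" "\<And>S. S \<in> A \<Longrightarrow> R' S \<Longrightarrow> R (shift_set i j A S)"
  shows "card {S \<in> A. R' S} \<le> card {S \<in> shift i j A. R S}"
  unfolding card_shift_filter using assms by (intro card_mono) auto

lemma shift_subset_ksets:
  assumes "finite V" "A \<subseteq> ksets V a" "i \<in> V"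
  shows "shift i j A \<subseteq> ksets V a"
proof
  fix S' assume "S' \<in> shift i j A"
  then obtain S where S: "S \<in> A" "S' = shift_set i j A S" by (auto simp: shift_def)
  then have "S \<subseteq> V" "card S = a" "finite S" using assms by (auto simp: ksets_def intro: finite_subset)
  then show "S' \<in> ksets V a"
    using assms S by (auto simp: ksets_def shift_set_def card_Suc_Diff1 simp del: card_Diff_insert)
qed

text \<open>If both sets move, they share \<open>i\<close>. If only \<open>T\<close> moves and
  \<open>S\<close> contains \<open>j\<close> but not \<open>i\<close>, then \<open>S\<close> stayed
  because its exchange already lies in \<open>A\<close>; that exchange meets \<open>T\<close>
  outside \<open>{i, j}\<close>, in a point that survives.\<close>

lemma cross_intersecting_shift:
  assumes "cross_intersecting A B" "i \<noteq> j"
  shows "cross_intersecting (shift i j A) (shift i j B)"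
proof -
  have ci: "\<And>S T. S \<in> A \<Longrightarrow> T \<in> B \<Longrightarrow> \<exists>x. x \<in> S \<and> x \<in> T"
    using assms by (auto simp: cross_intersecting_def)
  have "\<exists>x. x \<in> shift_set i j A S \<and> x \<in> shift_set i j B T" if S: "S \<in> A" and T: "T \<in> B" for S T
  proof (cases "shift_set i j A S = S")
    case S1: True
    show ?thesis
    proof (cases "shift_set i j B T = T")
      case True
      then show ?thesis using S1 ci[OF S T] by auto
    next
      case False
      then have T': "j \<in> T" "i \<notin> T" "shift_set i j B T = insert i (T - {j})"
        by (auto simp: shift_set_def split: if_splits)
      show ?thesis
      proof (cases "j \<in> S \<and> i \<notin> S")
        case True
        then have "insert i (S - {j}) \<in> A"
          using S1 by (auto simp: shift_set_def split: if_splits)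
        from ci[OF this T] show ?thesis using True T' S1 assms(2) by auto
      next
        case False
        then show ?thesis using ci[OF S T] T' S1 by auto
      qed
    qed
  next
    case False
    then have S': "j \<in> S" "i \<notin> S" "shift_set i j A S = insert i (S - {j})"
      by (auto simp: shift_set_def split: if_splits)
    show ?thesis
    proof (cases "shift_set i j B T = T")
      case T1: True
      show ?thesis
      proof (cases "j \<in> T \<and> i \<notin> T")
        case True
        then have "insert i (T - {j}) \<in> B"
          using T1 by (auto simp: shift_set_def split: if_splits)
        from ci[OF S this] show ?thesis using True S' T1 assms(2) by auto
      next
        case False
        then show ?thesis using ci[OF S T] S' T1 by auto
      qed
    next
      case False
      then have "i \<in> shift_set i j B T" by (auto simp: shift_set_def split: if_splits)
      then show ?thesis using S' by auto
    qed
  qed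
  then show ?thesis by (auto simp: cross_intersecting_def shift_def)
qed

lemma sum_shift_set_le:
  assumes "finite S" "i < j"
  shows "\<Sum>(shift_set i j A S) \<le> \<Sum>S" "shift_set i j A S \<noteq> S \<Longrightarrow> \<Sum>(shift_set i j A S) < \<Sum>S"
proof -
  have "\<Sum>(insert i (S - {j})) < \<Sum>S" if "j \<in> S" "i \<notin> S"
    using that assms by (simp add: sum.remove[of S j])
  then show "\<Sum>(shift_set i j A S) \<le> \<Sum>S" "shift_set i j A S \<noteq> S \<Longrightarrow> \<Sum>(shift_set i j A S) < \<Sum>S"
    by (auto simp: shift_set_def split: if_splits)
qed

lemma sum_shift:
  assumes "finite V" "A \<subseteq> Pow V" "i < j"
  shows "(\<Sum>S\<in>shift i j A. \<Sum>S) \<le> (\<Sum>S\<in>A. \<Sum>S)"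
    and "shift i j A \<noteq> A \<Longrightarrow> (\<Sum>S\<in>shift i j A. \<Sum>S) < (\<Sum>S\<in>A. \<Sum>S)"
proof -
  have fin: "finite A" "\<And>S. S \<in> A \<Longrightarrow> finite S"
    using assms by (auto intro: finite_subset[of _ V] finite_subset[of _ "Pow V"])
  have eq: "(\<Sum>S\<in>shift i j A. \<Sum>S) = (\<Sum>S\<in>A. \<Sum>(shift_set i j A S))"
    by (simp add: shift_def sum.reindex inj_on_shift_set)
  show "(\<Sum>S\<in>shift i j A. \<Sum>S) \<le> (\<Sum>S\<in>A. \<Sum>S)"
    unfolding eq using sum_shift_set_le(1)[OF _ assms(3)] fin by (intro sum_mono) auto
  assume "shift i j A \<noteq> A"
  then obtain S where S: "S \<in> A" "shift_set i j A S \<noteq> S"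
    by (force simp: shift_def)
  then have "\<Sum>(shift_set i j A S) < \<Sum>S" using sum_shift_set_le(2)[OF _ assms(3)] fin by blast
  then show "(\<Sum>S\<in>shift i j A. \<Sum>S) < (\<Sum>S\<in>A. \<Sum>S)"
    unfolding eq using sum_shift_set_le(1)[OF _ assms(3)] fin S
    by (intro sum_strict_mono_ex1) blast+
qed

text \<open>Every effective shift lowers the total of all elements of all members. Both families
  undergo the same shift, as cross-intersection requires, and the descent needs only one of them to
  change.\<close>

lemma shift_induct [consumes 3, case_names shifted shift]:
  assumes "finite V" "A \<subseteq> Pow V" "B \<subseteq> Pow V"
    and base: "\<And>A B. shifted V A \<Longrightarrow> shifted V B \<Longrightarrow> P A B"
    and step: "\<And>A B i j. i \<in> V \<Longrightarrow> j \<in> V \<Longrightarrow> i < j \<Longrightarrow> P (shift i j A) (shift i j B) \<Longrightarrow> P A B"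
  shows "P A B"
  using assms(2,3)
proof (induction "(\<Sum>S\<in>A. \<Sum>S) + (\<Sum>S\<in>B. \<Sum>S)" arbitrary: A B rule: less_induct)
  case less
  show ?case
  proof (cases "\<exists>i\<in>V. \<exists>j\<in>V. i < j \<and> (shift i j A \<noteq> A \<or> shift i j B \<noteq> B)")
    case True
    then obtain i j where ij: "i \<in> V" "j \<in> V" "i < j" and ne: "shift i j A \<noteq> A \<or> shift i j B \<noteq> B"
      by auto
    have "(\<Sum>S\<in>shift i j A. \<Sum>S) + (\<Sum>S\<in>shift i j B. \<Sum>S) < (\<Sum>S\<in>A. \<Sum>S) + (\<Sum>S\<in>B. \<Sum>S)"
      using ne sum_shift[OF assms(1) less.prems(1) ij(3)] sum_shift[OF assms(1) less.prems(2) ij(3)]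
      by linarith
    moreover have "shift i j C \<subseteq> Pow V" if "C \<subseteq> Pow V" for C
      using that ij by (auto simp: shift_def shift_set_def)
    ultimately show ?thesis
      using less.prems by (auto intro!: step[OF ij less.hyps])
  next
    case False
    have "shifted V C" if C: "C \<subseteq> Pow V" and fixed: "\<forall>i\<in>V. \<forall>j\<in>V. i < j \<longrightarrow> shift i j C = C" for C
      unfolding shifted_def
    proof (intro ballI impI)
      fix S i j assume S: "S \<in> C" "i \<in> V" "j \<in> S" "i < j" "i \<notin> S"
      then have "shift i j C = C" using C fixed by blast
      moreover have "shift_set i j C S \<in> shift i j C" using S by (auto simp: shift_def)
      ultimately show "insert i (S - {j}) \<in> C" using S by (auto simp: shift_set_def split: if_splits)
    qed
    then have "shifted V A" "shifted V B" using False less.prems by blast+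
    then show ?thesis by (rule base)
  qed
qed

subsection \<open>Sizes of cross-intersecting families\<close>

lemma ksets_subset_Pow: "ksets V a \<subseteq> Pow V"
  by (auto simp: ksets_def)

lemma finite_family: "finite V \<Longrightarrow> A \<subseteq> ksets V a \<Longrightarrow> finite A"
  using finite_subset finite_ksets by blast

text \<open>Shifting keeps sizes, uniformity and cross-intersection, so a claim about sizes alone
  loses nothing on the way back.\<close>

lemma cross_card_of_shifted:
  assumes "finite V" "A \<subseteq> ksets V a" "B \<subseteq> ksets V b" "cross_intersecting A B"
    and "\<And>A B. A \<subseteq> ksets V a \<Longrightarrow> B \<subseteq> ksets V b \<Longrightarrow> cross_intersecting A B \<Longrightarrow>
      shifted V A \<Longrightarrow> shifted V B \<Longrightarrow> R (card A) (card B)"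
  shows "R (card A) (card B)"
proof -
  have "A \<subseteq> Pow V" "B \<subseteq> Pow V" using assms(2,3) ksets_subset_Pow by blast+
  with assms(1) have "A \<subseteq> ksets V a \<longrightarrow> B \<subseteq> ksets V b \<longrightarrow> cross_intersecting A B \<longrightarrow> R (card A) (card B)"
  proof (induction rule: shift_induct)
    case (shifted A B)
    then show ?case using assms(5) by blast
  next
    case (shift A B i j)
    then show ?case
      using shift_subset_ksets[OF assms(1)] cross_intersecting_shift[of A B i j] by auto
  qed
  then show ?thesis using assms by blast
qed

lemma climbs_of_not_climbs:
  assumes "finite V" "A \<subseteq> ksets V a" "B \<subseteq> ksets V b" "cross_intersecting A B" "shifted V A"
    and "S \<in> A" "T \<in> B" "\<not> climbs V e T"
  shows "climbs V (3 - e) S"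
proof -
  have "meet_early V 1 S T"
    using assms by (intro meet_early_shifted[of V A B]) (auto simp: ksets_def)
  from meet_early_imp_climbs[OF this assms(8)] show ?thesis by (simp add: numeral_3_eq_3)
qed

lemma card_le_of_not_climbs:
  assumes "finite V" "A \<subseteq> ksets V a" "B \<subseteq> ksets V b" "cross_intersecting A B" "shifted V A"
  shows "card A \<le> card V choose (a - (3 - e)) \<or> card B \<le> card V choose (b - e)"
proof (cases "\<forall>T\<in>B. climbs V e T")
  case True
  then show ?thesis using card_all_climb_le assms by blast
next
  case False
  then have "\<And>S. S \<in> A \<Longrightarrow> climbs V (3 - e) S"
    using climbs_of_not_climbs assms by blast
  then show ?thesis using card_all_climb_le assms by blast
qed

lemma exists_least:
  assumes "finite V" "V \<noteq> {}"
  obtains v :: nat where "v \<in> V" "\<And>w. w \<in> V \<Longrightarrow> v \<le> w"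
  using assms Min_in Min_le by blast

text \<open>In the names below, \<open>i_j\<close> means that \<open>A\<close> is at most of the order of \<open>m choose (a - i)\<close> or \<open>B\<close> of
  \<open>m choose (b - j)\<close>. Truncated subtraction is harmless, as it only weakens these bounds.\<close>

lemma cross_card_1_1:
  assumes "finite V" "A \<subseteq> ksets V a" "B \<subseteq> ksets V b" "cross_intersecting A B"
  shows "card A \<le> card V choose (a - 1) \<or> card B \<le> card V choose (b - 1)"
proof (rule cross_card_of_shifted[where R = "\<lambda>x y. x \<le> card V choose (a - 1) \<or> y \<le> card V choose (b - 1)", OF assms], goal_cases)
  case (1 A B)
  show ?case
  proof (cases "\<forall>T\<in>B. climbs V 1 T")
    case True
    then show ?thesis using card_all_climb_le 1 assms(1) by blast
  next
    case False
    then have "\<And>S. S \<in> A \<Longrightarrow> climbs V (3 - 1) S"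
      using climbs_of_not_climbs 1 assms(1) by blast
    then have "\<And>S. S \<in> A \<Longrightarrow> climbs V 1 S" using climbs_mono by fastforce
    then show ?thesis using card_all_climb_le 1 assms(1) by blast
  qed
qed

lemma cross_card_1_2:
  assumes "finite V" "A \<subseteq> ksets V a" "B \<subseteq> ksets V b" "cross_intersecting A B"
  shows "card A \<le> card V choose (a - 1) \<or> card B \<le> card V choose (b - 2)"
  by (rule cross_card_of_shifted[where R = "\<lambda>x y. x \<le> card V choose (a - 1) \<or> y \<le> card V choose (b - 2)", OF assms])
     (use card_le_of_not_climbs[OF assms(1), of _ a _ b 2] in simp)

text \<open>Heights 1 and 3 exceed the total of 3 that \<open>climbs_of_not_climbs\<close> can share
  out. Splitting \<open>A\<close> at the least element \<open>v\<close> costs a factor 2: the sets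
  through \<open>v\<close> have one element fewer to choose, and those missing \<open>v\<close> must
  climb 1 afterwards, against a \<open>T\<close> that does not climb 3.\<close>

lemma cross_card_1_3:
  assumes "finite V" "A \<subseteq> ksets V a" "B \<subseteq> ksets V b" "cross_intersecting A B"
  shows "card A \<le> 2 * ((card V - 1) choose (a - 1)) \<or> card B \<le> card V choose (b - 3)"
proof (rule cross_card_of_shifted[where R = "\<lambda>x y. x \<le> 2 * ((card V - 1) choose (a - 1)) \<or> y \<le> card V choose (b - 3)", OF assms], goal_cases)
  case (1 A B)
  have finA: "finite A" using 1(1) assms(1) finite_family by blast
  show ?case
  proof (cases "\<forall>T\<in>B. climbs V 3 T")
    case True
    then show ?thesis using card_all_climb_le[OF assms(1) 1(2), of 3] by simp
  next
    case False
    then obtain T where T: "T \<in> B" "\<not> climbs V 3 T" by auto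
    have TV: "T \<subseteq> V" using T 1 by (auto simp: ksets_def)
    show ?thesis
    proof (cases "A = {}")
      case False
      then have "V \<noteq> {}" using T TV 1(3) by (auto simp: cross_intersecting_def)
      then obtain v where v: "v \<in> V" "\<And>w. w \<in> V \<Longrightarrow> v \<le> w" using exists_least assms(1) by blast
      have card: "card (V - {v}) = card V - 1" using v assms(1) by simp
      have "climbs (V - {v}) 1 S" if S: "S \<in> sect {} {v} A" for S
      proof -
        have SA: "S \<in> A" "S \<subseteq> V" "v \<notin> S" using S 1 by (auto simp: sect_def ksets_def)
        then have m: "meet_early V (Suc 0) S T"
          using meet_early_shifted[OF assms(1) 1(4) 1(3) SA(1) T(1)] TV by simp
        have Sv: "S - {v} = S" using SA by auto
        show ?thesis
        proof (cases "v \<in> T")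
          case True
          have m': "meet_early (V - {v}) 1 S (T - {v})"
            using meet_early_remove_least[OF assms(1) v m SA(2) TV] SA True Sv by simp
          have "\<not> climbs (V - {v}) 2 (T - {v})"
            using climbs_least_in[OF assms(1) v TV True, of 2] T by (simp add: numeral_3_eq_3)
          then show ?thesis using meet_early_imp_climbs[OF m'] by fastforce
        next
          case False
          then have Tv: "T - {v} = T" by auto
          have m': "meet_early (V - {v}) 2 S T"
            using meet_early_remove_least[OF assms(1) v m SA(2) TV] SA False Sv Tv
            by (simp add: numeral_2_eq_2)
          have "\<not> climbs (V - {v}) 4 T"
            using climbs_least_notin[OF assms(1) v TV False, of 2] T
            by (simp add: numeral_3_eq_3 eval_nat_numeral)
          then show ?thesis using meet_early_imp_climbs[OF m'] by fastforce
        qed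
      qed
      then have "card (sect {} {v} A) \<le> (card V - 1) choose (a - 1)"
        using card_sect_climbs_le[OF assms(1) 1(1), of "{}" "{v}" 1] card by (auto simp: sect_def)
      moreover have "card (sect {v} {} A) \<le> (card V - 1) choose (a - 1)"
        using card_sect_le[OF assms(1) 1(1), of "{v}" "{}"] card by simp
      ultimately show ?thesis
        using card_sect_split[OF finA, of "{}" "{}" v] by simp
    qed simp
  qed
qed

section \<open>Size bounds for opposite traces\<close>

lemma card_sect_le_choose:
  assumes "finite V" "A \<subseteq> ksets V a" "card (V - (P \<union> Q)) \<le> m" "a - card P = r"
  shows "card (sect P Q A) \<le> m choose r"
  using card_sect_le[OF assms(1,2), of P Q] binomial_right_mono[OF assms(3), of r] assms(4) by simp

text \<open>Leaving \<open>m\<close>, \<open>r\<close> and \<open>s\<close> free lets traces on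
  different ground sets and of different uniformities be measured by one common binomial
  coefficient.\<close>

lemma cross_sect_1_1:
  assumes "finite V" "A \<subseteq> ksets V a" "B \<subseteq> ksets V b" "cross_intersecting A B"
    and "card (V - (P \<union> Q)) \<le> m" "a - card P - 1 = r" "b - card Q - 1 = s"
  shows "card (sect P Q A) \<le> m choose r \<or> card (sect Q P B) \<le> m choose s"
proof -
  have "restr Q P B \<subseteq> ksets (V - (P \<union> Q)) (b - card Q)"
    using restr_subset_ksets[OF assms(1,3), of Q P] by (simp only: Un_commute)
  then have "card (restr P Q A) \<le> card (V - (P \<union> Q)) choose r \<or> card (restr Q P B) \<le> card (V - (P \<union> Q)) choose s"
    unfolding assms(6,7)[symmetric] using assms(1)
    by (intro cross_card_1_1 restr_subset_ksets[OF assms(1,2)] cross_intersecting_restr assms(4)) auto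
  then show ?thesis
    unfolding card_restr using binomial_right_mono[OF assms(5), of r]
      binomial_right_mono[OF assms(5), of s] by linarith
qed

lemma cross_sect_1_2:
  assumes "finite V" "A \<subseteq> ksets V a" "B \<subseteq> ksets V b" "cross_intersecting A B"
    and "card (V - (P \<union> Q)) \<le> m" "a - card P - 1 = r" "b - card Q - 2 = s"
  shows "card (sect P Q A) \<le> m choose r \<or> card (sect Q P B) \<le> m choose s"
proof -
  have "restr Q P B \<subseteq> ksets (V - (P \<union> Q)) (b - card Q)"
    using restr_subset_ksets[OF assms(1,3), of Q P] by (simp only: Un_commute)
  then have "card (restr P Q A) \<le> card (V - (P \<union> Q)) choose r \<or> card (restr Q P B) \<le> card (V - (P \<union> Q)) choose s"
    unfolding assms(6,7)[symmetric] using assms(1)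
    by (intro cross_card_1_2 restr_subset_ksets[OF assms(1,2)] cross_intersecting_restr assms(4)) auto
  then show ?thesis
    unfolding card_restr using binomial_right_mono[OF assms(5), of r]
      binomial_right_mono[OF assms(5), of s] by linarith
qed

lemma cross_sect_1_3:
  assumes "finite V" "A \<subseteq> ksets V a" "B \<subseteq> ksets V b" "cross_intersecting A B"
    and "card (V - (P \<union> Q)) \<le> m" "a - card P - 1 = r" "b - card Q - 3 = s"
  shows "card (sect P Q A) \<le> 2 * ((m - 1) choose r) \<or> card (sect Q P B) \<le> m choose s"
proof -
  have "restr Q P B \<subseteq> ksets (V - (P \<union> Q)) (b - card Q)"
    using restr_subset_ksets[OF assms(1,3), of Q P] by (simp only: Un_commute)
  then have "card (restr P Q A) \<le> 2 * ((card (V - (P \<union> Q)) - 1) choose r) \<or> card (restr Q P B) \<le> card (V - (P \<union> Q)) choose s"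
    unfolding assms(6,7)[symmetric] using assms(1)
    by (intro cross_card_1_3 restr_subset_ksets[OF assms(1,2)] cross_intersecting_restr assms(4)) auto
  then show ?thesis
    unfolding card_restr using binomial_right_mono[OF diff_le_mono[OF assms(5), of 1], of r]
      binomial_right_mono[OF assms(5), of s] by linarith
qed

lemma card_sect_restr:
  assumes "P' \<inter> P = {}" "Q' \<inter> P = {}"
  shows "card (sect P' Q' (restr P Q A)) = card (sect (P' \<union> P) (Q' \<union> Q) A)"
proof -
  have "P \<subseteq> S \<and> S \<inter> Q = {} \<and> P' \<subseteq> S - P \<and> (S - P) \<inter> Q' = {} \<longleftrightarrow>
      P' \<union> P \<subseteq> S \<and> S \<inter> (Q' \<union> Q) = {}" for S
    using assms by auto
  moreover have "sect P' Q' (restr P Q A) =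
      (\<lambda>S. S - P) ` {S \<in> A. P \<subseteq> S \<and> S \<inter> Q = {} \<and> P' \<subseteq> S - P \<and> (S - P) \<inter> Q' = {}}"
    unfolding sect_def restr_def by auto
  ultimately have "sect P' Q' (restr P Q A) = (\<lambda>S. S - P) ` sect (P' \<union> P) (Q' \<union> Q) A"
    by (simp add: sect_def)
  moreover have "inj_on (\<lambda>S. S - P) (sect (P' \<union> P) (Q' \<union> Q) A)"
    by (auto simp: inj_on_def sect_def)
  ultimately show ?thesis by (simp add: card_image)
qed

lemma card_split_pair:
  assumes "finite A"
  shows "card A = card (sect {i, j} {} A) + card (sect {i} {j} A) + card (sect {j} {i} A) + card (sect {} {i, j} A)"
    and "card (sect {} {j} A) = card (sect {i} {j} A) + card (sect {} {i, j} A)"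
    and "card (sect {j} {} A) = card (sect {i, j} {} A) + card (sect {j} {i} A)"
proof -
  have "card A = card (sect {j} {} A) + card (sect {} {j} A)"
    using card_sect_split[OF assms, of "{}" "{}" j] by simp
  moreover show n: "card (sect {} {j} A) = card (sect {i} {j} A) + card (sect {} {i, j} A)"
    by (rule card_sect_split[OF assms])
  moreover show p: "card (sect {j} {} A) = card (sect {i, j} {} A) + card (sect {j} {i} A)"
    by (rule card_sect_split[OF assms])
  ultimately show "card A = card (sect {i, j} {} A) + card (sect {i} {j} A) + card (sect {j} {i} A) + card (sect {} {i, j} A)"
    by linarith
qed

text \<open>This lemma and the next undo a shift: few sets missing \<open>Q\<close> afterwards means
  few before, for \<open>Q\<close> itself unless it contains \<open>i\<close> but not
  \<open>j\<close>, and with \<open>j\<close> added to it in that case.\<close>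

lemma card_sect_le_shift:
  assumes "finite A" "P = {}" "i \<notin> Q \<or> j \<in> Q"
  shows "card (sect P Q A) \<le> card (sect P Q (shift i j A))"
  unfolding sect_def using assms
  by (intro card_le_shift_filter) (auto simp: shift_set_def)

lemma card_sect_insert_le_shift:
  assumes "finite A" "i \<in> Q"
  shows "card (sect {} (insert j Q) A) \<le> card (sect {} Q (shift i j A))"
  unfolding sect_def using assms
  by (intro card_le_shift_filter) (auto simp: shift_set_def)

subsection \<open>Structure of large cross-intersecting families\<close>

lemma card_Diff_le_card: "finite V \<Longrightarrow> card (V - X) \<le> card V"
  by (rule card_mono) auto

text \<open>For shifted families \<open>y\<close> is the least element: \<open>B\<close> is too
  large for all its members to climb 2, so all of \<open>A\<close> climbs 1, and a member missing
  \<open>y\<close> has to climb 2 after it; likewise with the roles exchanged. Undoing a shift is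
  delicate only if \<open>y = i\<close>.\<close>

lemma cross_common_star:
  assumes "finite V" "A \<subseteq> ksets V a" "B \<subseteq> ksets V a" "cross_intersecting A B"
    and "4 * (card V choose (a - 2)) < card A" "4 * (card V choose (a - 2)) < card B"
  shows "\<exists>y\<in>V. card (sect {} {y} A) \<le> (card V - 1) choose (a - 2) \<and>
    card (sect {} {y} B) \<le> (card V - 1) choose (a - 2)"
proof -
  define u where "u = card V choose (a - 2)"
  define w where "w = (card V - 1) choose (a - 2)"
  have wu: "w \<le> u" unfolding u_def w_def by (rule binomial_right_mono) simp
  have "A \<subseteq> Pow V" "B \<subseteq> Pow V" using assms(2,3) ksets_subset_Pow by blast+
  with assms(1) have "A \<subseteq> ksets V a \<longrightarrow> B \<subseteq> ksets V a \<longrightarrow> cross_intersecting A B \<longrightarrow>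
    4 * u < card A \<longrightarrow> 4 * u < card B \<longrightarrow>
    (\<exists>y\<in>V. card (sect {} {y} A) \<le> w \<and> card (sect {} {y} B) \<le> w)"
  proof (induction rule: shift_induct)
    case (shifted A B)
    show ?case
    proof (intro impI)
      assume sub: "A \<subseteq> ksets V a" "B \<subseteq> ksets V a" and ci: "cross_intersecting A B"
        and big: "4 * u < card A" "4 * u < card B"
      have "A \<noteq> {}" "B \<noteq> {}" using big by auto
      then have "V \<noteq> {}" using sub ci by (force simp: ksets_def cross_intersecting_def)
      then obtain v where v: "v \<in> V" "\<And>w. w \<in> V \<Longrightarrow> v \<le> w" using exists_least assms(1) by blast
      have *: "card (sect {} {v} A) \<le> w"
        if sub: "A \<subseteq> ksets V a" "B \<subseteq> ksets V a" and ci: "cross_intersecting A B"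
          and sh: "shifted V A" and big: "4 * u < card B" for A B
      proof -
        have "\<not> (\<forall>T\<in>B. climbs V 2 T)"
          using card_all_climb_le[OF assms(1) sub(2), of 2] big by (auto simp: u_def)
        then obtain T where T: "T \<in> B" "\<not> climbs V 2 T" by auto
        have "climbs (V - {v}) 2 (S - {})" if S: "S \<in> sect {} {v} A" for S
        proof -
          have SA: "S \<in> A" "S \<subseteq> V" "v \<notin> S" using S sub by (auto simp: sect_def ksets_def)
          have "climbs V (Suc 0) S"
            using climbs_of_not_climbs[OF assms(1) sub ci sh SA(1) T] by simp
          then show ?thesis
            using climbs_least_notin[OF assms(1) v SA(2,3), of 0] by (simp add: numeral_2_eq_2)
        qed
        then show ?thesis
          using card_sect_climbs_le[OF assms(1) sub(1), of "{}" "{v}" 2] v assms(1) by (simp add: w_def)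
      qed
      from *[OF sub ci shifted(1) big(2)] *[OF sub(2,1) cross_intersecting_sym[OF ci] shifted(2) big(1)]
      show "\<exists>y\<in>V. card (sect {} {y} A) \<le> w \<and> card (sect {} {y} B) \<le> w" using v by blast
    qed
  next
    case (shift A B i j)
    show ?case
    proof (intro impI)
      assume sub: "A \<subseteq> ksets V a" "B \<subseteq> ksets V a" and ci: "cross_intersecting A B"
        and big: "4 * u < card A" "4 * u < card B"
      have fin: "finite A" "finite B" using sub assms(1) finite_family by blast+
      have ij: "i \<noteq> j" using shift by auto
      obtain y where y: "y \<in> V" "card (sect {} {y} (shift i j A)) \<le> w" "card (sect {} {y} (shift i j B)) \<le> w"
        using shift shift_subset_ksets[OF assms(1)] sub cross_intersecting_shift[OF ci ij] big by auto
      show "\<exists>y\<in>V. card (sect {} {y} A) \<le> w \<and> card (sect {} {y} B) \<le> w"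
      proof (cases "y = i")
        case False
        then have "card (sect {} {y} A) \<le> w" "card (sect {} {y} B) \<le> w"
          using y card_sect_le_shift[OF fin(1), of "{}" i "{y}" j]
            card_sect_le_shift[OF fin(2), of "{}" i "{y}" j] by auto
        then show ?thesis using y by blast
      next
        case True
        \<comment> \<open>Self-improvement: with at most \<open>2 * u\<close> exceptions, more than
          \<open>2 * u\<close> members contain \<open>z\<close>, which forces the other family down
          to \<open>w\<close> exceptions.\<close>
        have star: "card (sect {} {z} A) \<le> w \<and> card (sect {} {z} B) \<le> w"
          if z: "z \<in> V" and le: "card (sect {} {z} A) \<le> 2 * u" "card (sect {} {z} B) \<le> 2 * u" for z
        proof -
          have *: "card (sect {} {z} B) \<le> w" if sub: "A \<subseteq> ksets V a" "B \<subseteq> ksets V a" and ci: "cross_intersecting A B"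
            and big: "4 * u < card A" and le: "card (sect {} {z} A) \<le> 2 * u" for A B
          proof -
            have "card (sect {z} {} A) \<le> w \<or> card (sect {} {z} B) \<le> w"
              unfolding w_def
              by (rule cross_sect_1_2[OF assms(1) sub ci]) (use z assms(1) in auto)
            moreover have "2 * u < card (sect {z} {} A)"
              using card_sect_split[OF finite_family[OF assms(1) sub(1)], of "{}" "{}" z] big le by simp
            ultimately show ?thesis using wu by linarith
          qed
          from *[OF sub ci big(1) le(1)] *[OF sub(2,1) cross_intersecting_sym[OF ci] big(2) le(2)]
          show ?thesis by simp
        qed
        have both: "card (sect {} {i, j} A) \<le> u" "card (sect {} {i, j} B) \<le> u"
          using y(2,3) wu card_sect_insert_le_shift[OF fin(1), of i "{i}" j]
            card_sect_insert_le_shift[OF fin(2), of i "{i}" j] by (simp_all add: True insert_commute)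
        have one: "card (sect {i} {j} A) \<le> u \<or> card (sect {j} {i} B) \<le> u"
          "card (sect {j} {i} A) \<le> u \<or> card (sect {i} {j} B) \<le> u"
          using cross_sect_1_1[OF assms(1) sub ci card_Diff_le_card[OF assms(1)], where P = "{i}" and Q = "{j}" and r = "a - 2" and s = "a - 2"]
            cross_sect_1_1[OF assms(1) sub ci card_Diff_le_card[OF assms(1)], where P = "{j}" and Q = "{i}" and r = "a - 2" and s = "a - 2"]
          by (simp_all add: u_def)
        have "card (sect {i, j} {} A) \<le> u" "card (sect {i, j} {} B) \<le> u"
          using card_sect_le_choose[OF assms(1) sub(1) card_Diff_le_card[OF assms(1)], where P = "{i, j}" and Q = "{}" and r = "a - 2"]
            card_sect_le_choose[OF assms(1) sub(2) card_Diff_le_card[OF assms(1)], where P = "{i, j}" and Q = "{}" and r = "a - 2"] ij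
          by (simp_all add: u_def)
        \<comment> \<open>If both small traces in \<open>one\<close> belonged to the same family,
          that family would consist of four traces of size at most \<open>u\<close>. So there is one
          in each family, with the same element of the pair inside, and the other element carries
          the star.\<close>
        then have "card (sect {} {i} A) \<le> 2 * u \<and> card (sect {} {i} B) \<le> 2 * u \<or>
            card (sect {} {j} A) \<le> 2 * u \<and> card (sect {} {j} B) \<le> 2 * u"
          using one both big card_split_pair[OF fin(1), of i j] card_split_pair[OF fin(2), of i j]
            card_split_pair(2)[OF fin(1), of j i] card_split_pair(2)[OF fin(2), of j i]
          unfolding insert_commute[of j i "{}"] by linarith
        then show ?thesis using star shift(1,2) by blast
      qed
    qed
  qed
  then show ?thesis using assms unfolding u_def w_def by blast
qed

text \<open>Either almost all members of both families contain \<open>y\<close>, or almost all members of \<open>A\<close> meet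
  \<open>{y, z}\<close> and almost all members of \<open>B\<close> contain it.\<close>

definition star_or_cover :: "nat set \<Rightarrow> nat \<Rightarrow> nat set set \<Rightarrow> nat set set \<Rightarrow> bool" where
  "star_or_cover V u A B \<longleftrightarrow>
     (\<exists>y\<in>V. card (sect {} {y} A) \<le> 4 * u \<and> card (sect {} {y} B) \<le> u) \<or>
     (\<exists>y\<in>V. \<exists>z\<in>V. y \<noteq> z \<and> card (sect {} {y, z} A) \<le> u \<and>
        card (sect {} {y} B) \<le> u \<and> card (sect {} {z} B) \<le> u)"

section \<open>Cross-intersecting families of consecutive uniformities\<close>

context
  fixes V :: "nat set" and a u :: nat and A B :: "nat set set"
  assumes fin: "finite V" and u: "u = card V choose (a - 2)"
    and sub: "A \<subseteq> ksets V a" "B \<subseteq> ksets V (Suc a)" and ci: "cross_intersecting A B"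
    and big: "7 * u < card A" "5 * u < card B"
begin

private lemma finA: "finite A" and finB: "finite B"
  using sub fin finite_family by blast+

text \<open>The link has uniformity \<open>a - 1\<close> and \<open>B\<close> has
  \<open>a + 1\<close>; only the unbalanced bound with 1 and 3 brings both down to
  \<open>choose (a - 2)\<close>.\<close>

lemma other_nearly_star:
  assumes "y \<in> V" "2 * u < card (sect {y} {} A)"
  shows "card (sect {} {y} B) \<le> u"
proof -
  have "2 * ((card V - 1) choose (a - 2)) \<le> 2 * u"
    unfolding u by (simp add: binomial_right_mono)
  then show ?thesis
    using cross_sect_1_3[OF fin sub ci card_Diff_le_card[OF fin], where P = "{y}" and Q = "{}" and r = "a - 2" and s = "a - 2"]
      assms(2) by (auto simp: u)
qed

text \<open>The hypothesis counts the members of \<open>B\<close> that miss \<open>y\<close> or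
  \<open>z\<close>. More than \<open>u\<close> members contain both, so few sets of \<open>A\<close>
  miss both. If \<open>y\<close> and \<open>z\<close> both have large degree in \<open>A\<close>,
  this is the cover; if one has degree at most \<open>2 * u\<close>, the other is the centre of a
  star.\<close>

lemma star_or_cover_of_cover:
  assumes yz: "y \<in> V" "z \<in> V" "y \<noteq> z"
    and le: "card (sect {} {y} B) + card (sect {y} {z} B) \<le> 4 * u"
  shows "star_or_cover V u A B"
proof -
  have "u < card (sect {y, z} {} B)"
    using le big card_sect_split[OF finB, of "{}" "{}" y] card_sect_split[OF finB, of "{y}" "{}" z]
    by (simp add: insert_commute)
  then have yzA: "card (sect {} {y, z} A) \<le> u"
    using cross_sect_1_2[OF fin sub(2,1) cross_intersecting_sym[OF ci] card_Diff_le_card[OF fin],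
        where P = "{y, z}" and Q = "{}" and r = "a - 2" and s = "a - 2"] yz(3)
    by (auto simp: u)
  have star: "star_or_cover V u A B"
    if "y \<in> V" "card (sect {z} {} A) \<le> 2 * u" "card (sect {} {y, z} A) \<le> u" for y z
  proof -
    have "card (sect {z} {y} A) \<le> card (sect {z} {} A)"
      by (rule card_sect_mono[OF finA]) auto
    then have "card (sect {} {y} A) \<le> 3 * u"
      using that card_sect_split[OF finA, of "{}" "{y}" z] by (simp add: insert_commute)
    moreover from this have "2 * u < card (sect {y} {} A)"
      using big card_sect_split[OF finA, of "{}" "{}" y] by simp
    ultimately show ?thesis
      using other_nearly_star that(1) unfolding star_or_cover_def by force
  qed
  show ?thesis
  proof (cases "card (sect {z} {} A) \<le> 2 * u \<or> card (sect {y} {} A) \<le> 2 * u")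
    case True
    then show ?thesis
      using star[of y z] star[of z y] yz yzA by (auto simp: insert_commute)
  next
    case False
    then have "card (sect {} {y} B) \<le> u" "card (sect {} {z} B) \<le> u"
      using other_nearly_star yz by auto
    then show ?thesis using yz yzA unfolding star_or_cover_def by blast
  qed
qed

text \<open>This restores 4 from 5 after a lossy step. If more than \<open>4 * u\<close> sets of
  \<open>A\<close> miss \<open>y\<close>, they and the link of \<open>B\<close> at \<open>y\<close>,
  of the same uniformity, have a common star \<open>z\<close>, and \<open>{y, z}\<close> is a cover.
  Hence the constants 7 = 5 + 2, where \<open>2 * u\<close> feeds \<open>other_nearly_star\<close>,
  and 5 = 4 + 1.\<close>

lemma star_or_cover_of_star:
  assumes y: "y \<in> V" and le: "card (sect {} {y} A) \<le> 5 * u"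
  shows "star_or_cover V u A B"
proof -
  have "2 * u < card (sect {y} {} A)"
    using big le card_sect_split[OF finA, of "{}" "{}" y] by simp
  then have By: "card (sect {} {y} B) \<le> u" by (rule other_nearly_star[OF y])
  show ?thesis
  proof (cases "card (sect {} {y} A) \<le> 4 * u")
    case True
    then show ?thesis using By y unfolding star_or_cover_def by blast
  next
    case False
    let ?W = "V - {y}"
    have le_u: "card ?W choose (a - 2) \<le> u" "(card ?W - 1) choose (a - 2) \<le> u"
      unfolding u using y fin by (auto intro!: binomial_right_mono)
    have "restr {} {y} A \<subseteq> ksets ?W a" "restr {y} {} B \<subseteq> ksets ?W a"
      using restr_subset_ksets[OF fin sub(1), of "{}" "{y}"]
        restr_subset_ksets[OF fin sub(2), of "{y}" "{}"] by simp_all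
    moreover have "4 * u < card (restr {y} {} B)"
      using By big card_sect_split[OF finB, of "{}" "{}" y] by (simp add: card_restr)
    ultimately obtain z where z: "z \<in> ?W" "card (sect {} {z} (restr {y} {} B)) \<le> u"
      using cross_common_star[of ?W "restr {} {y} A" a "restr {y} {} B"]
        cross_intersecting_restr[OF ci, of "{}" "{y}"] fin False le_u
      by (force simp: card_restr)
    then have "card (sect {y} {z} B) \<le> u" by (simp add: card_sect_restr)
    then show ?thesis using By y z by (intro star_or_cover_of_cover[of y z]) auto
  qed
qed

text \<open>The hypotheses of the next two lemmas are what a star at \<open>i\<close>, or a cover \<open>{i, y}\<close>, of the families
  shifted from \<open>j\<close> to \<open>i\<close> says about the original families.\<close>

lemma star_or_cover_of_shift_star:
  assumes ij: "i \<in> V" "j \<in> V" "i \<noteq> j"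
    and le: "card (sect {} {i, j} A) \<le> 4 * u" "card (sect {} {i, j} B) \<le> u"
  shows "star_or_cover V u A B"
proof -
  have one: "card (sect {i} {j} A) \<le> u \<or> card (sect {j} {i} B) \<le> u"
    "card (sect {j} {i} A) \<le> u \<or> card (sect {i} {j} B) \<le> u"
    using cross_sect_1_2[OF fin sub ci card_Diff_le_card[OF fin], where P = "{i}" and Q = "{j}" and r = "a - 2" and s = "a - 2"]
      cross_sect_1_2[OF fin sub ci card_Diff_le_card[OF fin], where P = "{j}" and Q = "{i}" and r = "a - 2" and s = "a - 2"]
    by (simp_all add: u)
  have ijA: "card (sect {i, j} {} A) \<le> u"
    using card_sect_le_choose[OF fin sub(1) card_Diff_le_card[OF fin], where P = "{i, j}" and Q = "{}" and r = "a - 2"] ij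
    by (simp add: u)
  note A = card_split_pair[OF finA, of i j] card_split_pair(2)[OF finA, of j i]
  note B = card_split_pair[OF finB, of i j] card_split_pair(2)[OF finB, of j i]
  \<comment> \<open>Either \<open>A\<close> has a small one-sided trace, which adds \<open>u\<close>
    to the \<open>4 * u\<close> sets missing both elements, or both one-sided traces of
    \<open>B\<close> are small and few sets of \<open>B\<close> miss \<open>i\<close> or
    \<open>j\<close>.\<close>
  have "card (sect {} {j} A) \<le> 5 * u \<or> card (sect {} {i} A) \<le> 5 * u \<or>
      card (sect {} {j} B) + card (sect {j} {i} B) \<le> 4 * u"
    using one ijA le A B big(1) unfolding insert_commute[of j i "{}"] by linarith
  then show ?thesis
    using star_or_cover_of_star star_or_cover_of_cover[of j i] ij by auto
qed

lemma star_or_cover_of_shift_cover: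
  assumes ij: "i \<in> V" "j \<in> V" "i \<noteq> j" and y: "y \<in> V" "y \<noteq> i" "y \<noteq> j"
    and le: "card (sect {} {i, j, y} A) \<le> u" "card (sect {} {y} B) \<le> u" "card (sect {} {i, j} B) \<le> u"
  shows "star_or_cover V u A B"
proof -
  have one: "card (sect {i, y} {j} B) \<le> u \<or> card (sect {j} {i, y} A) \<le> u"
    "card (sect {j, y} {i} B) \<le> u \<or> card (sect {i} {j, y} A) \<le> u"
    using cross_sect_1_1[OF fin sub(2,1) cross_intersecting_sym[OF ci] card_Diff_le_card[OF fin],
        where P = "{i, y}" and Q = "{j}" and r = "a - 2" and s = "a - 2"]
      cross_sect_1_1[OF fin sub(2,1) cross_intersecting_sym[OF ci] card_Diff_le_card[OF fin],
        where P = "{j, y}" and Q = "{i}" and r = "a - 2" and s = "a - 2"] y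
    by (simp_all add: u)
  have all: "card (sect {i, j, y} {} B) \<le> u" "card (sect {i, j} {y} A) \<le> u"
    using card_sect_le_choose[OF fin sub(2) card_Diff_le_card[OF fin], where P = "{i, j, y}" and Q = "{}" and r = "a - 2"]
      card_sect_le_choose[OF fin sub(1) card_Diff_le_card[OF fin], where P = "{i, j}" and Q = "{y}" and r = "a - 2"] ij y
    by (simp_all add: u)
  have A: "card (sect {} {y} A) = card (sect {i, j} {y} A) + card (sect {i} {j, y} A)
      + card (sect {j} {i, y} A) + card (sect {} {i, j, y} A)"
    using card_sect_split[OF finA, of "{}" "{y}" j] card_sect_split[OF finA, of "{j}" "{y}" i]
      card_sect_split[OF finA, of "{}" "{j, y}" i] by simp
  have By: "card (sect {y} {i, j} B) \<le> u"
    using card_sect_mono[OF finB, of "{}" "{y}" "{i, j}" "{i, j}"] le(3) by simp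
  have B: "card B = card (sect {y} {} B) + card (sect {} {y} B)"
    "card (sect {y} {} B) = card (sect {j, y} {} B) + card (sect {y} {j} B)"
    "card (sect {j, y} {} B) = card (sect {i, j, y} {} B) + card (sect {j, y} {i} B)"
    "card (sect {y} {j} B) = card (sect {i, y} {j} B) + card (sect {y} {i, j} B)"
    "card (sect {y} {i} B) = card (sect {j, y} {i} B) + card (sect {y} {i, j} B)"
    using card_sect_split[OF finB, of "{}" "{}" y] card_sect_split[OF finB, of "{y}" "{}" j]
      card_sect_split[OF finB, of "{j, y}" "{}" i] card_sect_split[OF finB, of "{y}" "{j}" i]
      card_sect_split[OF finB, of "{y}" "{i}" j] by (simp_all add: insert_commute)
  \<comment> \<open>If \<open>one\<close> bounds both traces of \<open>A\<close>, then
    \<open>y\<close> is a star; if it bounds a trace of \<open>B\<close>, then \<open>y\<close>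
    together with \<open>j\<close> or \<open>i\<close> lies in almost all of
    \<open>B\<close>.\<close>
  have "card (sect {} {y} A) \<le> 5 * u \<or> card (sect {} {y} B) + card (sect {y} {j} B) \<le> 4 * u \<or>
      card (sect {} {y} B) + card (sect {y} {i} B) \<le> 4 * u"
    using one all le A B By big(2) by linarith
  then show ?thesis
    using star_or_cover_of_star[of y] star_or_cover_of_cover[of y i] star_or_cover_of_cover[of y j] ij y by auto
qed

text \<open>If all of \<open>A\<close> climbs 1, the least element is a star. Otherwise all of
  \<open>B\<close> climbs 2, which sets missing one of the two least elements can do only by a
  further climb, so these two elements form a cover.\<close>

lemma star_or_cover_shifted:
  assumes "shifted V A" "shifted V B"
  shows "star_or_cover V u A B"
proof -
  have "A \<noteq> {}" "B \<noteq> {}" using big by auto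
  then have "V \<noteq> {}" using sub ci by (force simp: ksets_def cross_intersecting_def)
  then obtain v where v: "v \<in> V" "\<And>w. w \<in> V \<Longrightarrow> v \<le> w" using exists_least fin by blast
  have cW: "card (V - {v}) \<le> card V" by (rule card_Diff_le_card[OF fin])
  show ?thesis
  proof (cases "\<forall>S\<in>A. climbs V 1 S")
    case True
    have "climbs (V - {v}) 2 S" if "S \<in> sect {} {v} A" for S
      using that True sub climbs_least_notin[OF fin v, of S 0]
      by (auto simp: sect_def ksets_def numeral_2_eq_2)
    then have "card (sect {} {v} A) \<le> card (V - {v}) choose (a - 2)"
      using card_sect_climbs_le[OF fin sub(1), of "{}" "{v}" 2] by simp
    then have "card (sect {} {v} A) \<le> 5 * u"
      using binomial_right_mono[OF cW, of "a - 2"] u by simp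
    then show ?thesis using star_or_cover_of_star v by blast
  next
    case False
    then obtain S where S: "S \<in> A" "\<not> climbs V 1 S" by auto
    have climb: "climbs V 2 T" if "T \<in> B" for T
      using climbs_of_not_climbs[OF fin sub(2,1) cross_intersecting_sym[OF ci] assms(2) that S] by simp
    have TV: "T \<subseteq> V" if "T \<in> B" for T using that sub by (auto simp: ksets_def)
    obtain T where "T \<in> B" using \<open>B \<noteq> {}\<close> by auto
    then have "T \<subseteq> V" "2 \<le> card T" using climb climbs_le_card[OF fin TV] TV by blast+
    then have "2 \<le> card V" using card_mono[OF fin] order_trans by blast
    then have "V - {v} \<noteq> {}" using card_mono[of "{v}" V] by (auto simp: Diff_eq_empty_iff)
    then obtain v' where v': "v' \<in> V - {v}" "\<And>w. w \<in> V - {v} \<Longrightarrow> v' \<le> w"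
      using exists_least[of "V - {v}"] fin by blast
    have "climbs (V - {v}) 3 T" if "T \<in> sect {} {v} B" for T
      using that climb[of T] TV[of T] climbs_least_notin[OF fin v, of T 1]
      by (auto simp: sect_def numeral_2_eq_2 numeral_3_eq_3)
    then have 1: "card (sect {} {v} B) \<le> card (V - {v}) choose (a - 2)"
      using card_sect_climbs_le[OF fin sub(2), of "{}" "{v}" 3] by simp
    have "climbs (V - ({v} \<union> {v'})) 2 (T - {v})" if "T \<in> sect {v} {v'} B" for T
    proof -
      have T: "T \<in> B" "v \<in> T" "v' \<notin> T - {v}" "T - {v} \<subseteq> V - {v}"
        using that TV[of T] by (auto simp: sect_def)
      then have "climbs (V - {v}) (Suc 0) (T - {v})"
        using climb[of T] TV[of T] climbs_least_in[OF fin v, of T 1] by (simp add: numeral_2_eq_2)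
      then have "climbs (V - {v} - {v'}) 2 (T - {v})"
        using climbs_least_notin[OF _ v' T(4,3), of 0] fin by (simp add: numeral_2_eq_2)
      moreover have "V - {v} - {v'} = V - ({v} \<union> {v'})" by auto
      ultimately show ?thesis by simp
    qed
    then have "card (sect {v} {v'} B) \<le> card (V - ({v} \<union> {v'})) choose (a - 2)"
      using card_sect_climbs_le[OF fin sub(2), of "{v}" "{v'}" 2] by simp
    then have "card (sect {} {v} B) + card (sect {v} {v'} B) \<le> 4 * u"
      using 1 binomial_right_mono[OF cW, of "a - 2"]
        binomial_right_mono[OF card_Diff_le_card[OF fin], of "{v} \<union> {v'}" "a - 2"] unfolding u by linarith
    then show ?thesis using v v' by (intro star_or_cover_of_cover[of v v']) auto
  qed
qed

end

lemma cross_star_or_cover: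
  assumes "finite V" and u: "u = card V choose (a - 2)"
    and "A \<subseteq> ksets V a" "B \<subseteq> ksets V (Suc a)" "cross_intersecting A B"
    and "7 * u < card A" "5 * u < card B"
  shows "star_or_cover V u A B"
proof -
  have "A \<subseteq> Pow V" "B \<subseteq> Pow V" using assms(3,4) ksets_subset_Pow by blast+
  with assms(1) have "A \<subseteq> ksets V a \<longrightarrow> B \<subseteq> ksets V (Suc a) \<longrightarrow> cross_intersecting A B \<longrightarrow>
    7 * u < card A \<longrightarrow> 5 * u < card B \<longrightarrow> star_or_cover V u A B"
  proof (induction rule: shift_induct)
    case (shifted A B)
    then show ?case using star_or_cover_shifted[OF assms(1) u] by blast
  next
    case (shift A B i j)
    show ?case
    proof (intro impI)
      assume sub: "A \<subseteq> ksets V a" "B \<subseteq> ksets V (Suc a)" and ci: "cross_intersecting A B"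
        and big: "7 * u < card A" "5 * u < card B"
      note hyps = assms(1) u sub ci big
      have finA: "finite A" and finB: "finite B" using sub assms(1) finite_family by blast+
      have ij: "i \<in> V" "j \<in> V" "i \<noteq> j" using shift by auto
      note leA = card_sect_le_shift[OF finA refl, of i _ j] and leB = card_sect_le_shift[OF finB refl, of i _ j]
      have "star_or_cover V u (shift i j A) (shift i j B)"
        using shift shift_subset_ksets[OF assms(1)] sub cross_intersecting_shift[OF ci ij(3)] big by auto
      then consider (star) y where "y \<in> V" "card (sect {} {y} (shift i j A)) \<le> 4 * u"
          "card (sect {} {y} (shift i j B)) \<le> u"
        | (cover) y z where "y \<in> V" "z \<in> V" "y \<noteq> z" "card (sect {} {y, z} (shift i j A)) \<le> u"
          "card (sect {} {y} (shift i j B)) \<le> u" "card (sect {} {z} (shift i j B)) \<le> u"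
        unfolding star_or_cover_def by blast
      then show "star_or_cover V u A B"
      proof cases
        case star
        show ?thesis
        proof (cases "y = i")
          case True
          then have "card (sect {} {i, j} A) \<le> 4 * u" "card (sect {} {i, j} B) \<le> u"
            using star card_sect_insert_le_shift[OF finA, of i "{i}" j]
              card_sect_insert_le_shift[OF finB, of i "{i}" j] by (simp_all add: insert_commute)
          then show ?thesis using star_or_cover_of_shift_star[OF hyps ij] by blast
        next
          case False
          then have "card (sect {} {y} A) \<le> 4 * u" "card (sect {} {y} B) \<le> u"
            using star leA[of "{y}"] leB[of "{y}"] by auto
          then show ?thesis using star unfolding star_or_cover_def by blast
        qed
      next
        have *: "star_or_cover V u A B"
          if cover: "y \<in> V" "z \<in> V" "y \<noteq> z" "z \<noteq> i" "card (sect {} {y, z} (shift i j A)) \<le> u"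
            "card (sect {} {y} (shift i j B)) \<le> u" "card (sect {} {z} (shift i j B)) \<le> u" for y z
        proof -
          have Bz: "card (sect {} {z} B) \<le> u" using cover leB[of "{z}"] by auto
          show ?thesis
          proof (cases "y = i")
            case False
            then have "card (sect {} {y, z} A) \<le> u" "card (sect {} {y} B) \<le> u"
              using cover leA[of "{y, z}"] leB[of "{y}"] by auto
            then show ?thesis using cover Bz unfolding star_or_cover_def by blast
          next
            case y: True
            have Bij: "card (sect {} {i, j} B) \<le> u"
              using cover y card_sect_insert_le_shift[OF finB, of i "{i}" j] by (simp add: insert_commute)
            show ?thesis
            proof (cases "z = j")
              case False
              have "card (sect {} {i, j, z} A) \<le> u"
                using cover y card_sect_insert_le_shift[OF finA, of i "{i, z}" j] by (simp add: insert_commute)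
              then show ?thesis
                using star_or_cover_of_shift_cover[OF hyps ij cover(2,4) False _ Bz Bij] by blast
            next
              case True
              have sp: "card {S \<in> C. \<not> (i \<in> S \<and> j \<in> S)} = card (sect {} {j} C) + card (sect {j} {i} C)"
                if "finite C" for C :: "nat set set"
              proof -
                have "{S \<in> C. \<not> (i \<in> S \<and> j \<in> S)} = sect {} {j} C \<union> sect {j} {i} C"
                  by (auto simp: sect_def)
                also have "card \<dots> = card (sect {} {j} C) + card (sect {j} {i} C)"
                  using that by (intro card_Un_disjoint) (auto simp: sect_def)
                finally show ?thesis .
              qed
              have finS: "finite (shift i j B)" using finB by (simp add: shift_def)
              \<comment> \<open>For the cover \<open>{i, j}\<close> itself: no set gains both
                elements by the shift, so the sets lacking one of them do not become fewer.\<close>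
              have "card {S \<in> B. \<not> (i \<in> S \<and> j \<in> S)} \<le> card {S \<in> shift i j B. \<not> (i \<in> S \<and> j \<in> S)}"
                using finB ij by (intro card_le_shift_filter) (auto simp: shift_set_def)
              moreover have "card (sect {j} {i} (shift i j B)) \<le> card (sect {} {i} (shift i j B))"
                by (rule card_sect_mono[OF finS]) auto
              ultimately have "card (sect {} {j} B) + card (sect {j} {i} B) \<le> 4 * u"
                using sp[OF finB] sp[OF finS] cover y True by simp
              then show ?thesis using star_or_cover_of_cover[OF hyps, of j i] ij by auto
            qed
          qed
        qed
        case (cover y z)
        then show ?thesis using *[of y z] *[of z y] by (cases "z = i") (auto simp: insert_commute)
      qed
    qed
  qed
  then show ?thesis using assms by blast
qed

subsection \<open>Elements of large degree\<close>

text \<open>The triangle family has degree sum at least 2 per member; the last three terms make up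
  for the members with at most one of \<open>x, y, z\<close>.\<close>

lemma sum_three_degrees:
  assumes "finite F"
  shows "2 * card F \<le> card (sect {x} {} F) + card (sect {y} {} F) + card (sect {z} {} F)
    + card (sect {} {x, y} F) + card (sect {} {x, z} F) + card (sect {x} {y, z} F)"
proof -
  have deg: "card F = card (sect {w} {} F) + card (sect {} {w} F)" for w
    using card_sect_split[OF assms, of "{}" "{}" w] by simp
  have "card (sect {} {z} F) = card (sect {x} {z} F) + card (sect {} {x, z} F)"
    "card (sect {x} {z} F) = card (sect {y, x} {z} F) + card (sect {x} {y, z} F)"
    "card (sect {} {x} F) = card (sect {y} {x} F) + card (sect {} {y, x} F)"
    "card (sect {x} {} F) = card (sect {y, x} {} F) + card (sect {x} {y} F)"
    "card (sect {} {y} F) = card (sect {x} {y} F) + card (sect {} {x, y} F)"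
    by (rule card_sect_split[OF assms])+
  moreover have "card (sect {y, x} {z} F) \<le> card (sect {y, x} {} F)"
    by (rule card_sect_mono[OF assms]) auto
  moreover have "{y, x} = {x, y}" by auto
  ultimately show ?thesis
    using deg[of x] deg[of y] deg[of z] by simp
qed

section \<open>Degrees in one intersecting family\<close>

context
  fixes V :: "nat set" and k u :: nat and F :: "nat set set"
  assumes fin: "finite V" and k: "3 \<le> k" and u: "u = (card V - 1) choose (k - 3)"
    and sub: "F \<subseteq> ksets V k" and ci: "cross_intersecting F F"
begin

private lemma finF: "finite F"
  using sub fin finite_family by blast

private lemma deg: "card F = card (sect {w} {} F) + card (sect {} {w} F)"
  using card_sect_split[OF finF, of "{}" "{}" w] by simp

text \<open>The link at \<open>x\<close> and the sets missing \<open>x\<close> are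
  cross-intersecting of uniformities \<open>k - 1\<close> and \<open>k\<close>. A star
  \<open>y\<close> of both is missed by at most \<open>5 * u\<close> sets; a cover
  \<open>{y, z}\<close> makes \<open>F\<close> almost a triangle family on \<open>x, y, z\<close>,
  whose average degree exceeds half.\<close>

lemma large_degree_of_balanced:
  assumes x: "x \<in> V" and big: "7 * u < card (sect {x} {} F)" "5 * u < card (sect {} {x} F)"
  shows "\<exists>y\<in>V. card F < 2 * card (sect {y} {} F)"
proof -
  let ?W = "V - {x}"
  have card: "card F = card (sect {x} {} F) + card (sect {} {x} F)" by (rule deg)
  have "star_or_cover ?W u (restr {x} {} F) (restr {} {x} F)"
  proof (rule cross_star_or_cover)
    show "u = card ?W choose (k - 1 - 2)" using x fin by (simp add: u numeral_3_eq_3)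
    show "restr {x} {} F \<subseteq> ksets ?W (k - 1)" "restr {} {x} F \<subseteq> ksets ?W (Suc (k - 1))"
      using restr_subset_ksets[OF fin sub, of "{x}" "{}"] restr_subset_ksets[OF fin sub, of "{}" "{x}"] k
      by simp_all
  qed (use fin big cross_intersecting_restr[OF ci] in \<open>simp_all add: card_restr\<close>)
  then consider (star) y where "y \<in> V" "y \<noteq> x" "card (sect {x} {y} F) \<le> 4 * u" "card (sect {} {x, y} F) \<le> u"
    | (cover) y z where "y \<in> V" "z \<in> V" "y \<noteq> x" "z \<noteq> x" "card (sect {x} {y, z} F) \<le> u"
      "card (sect {} {x, y} F) \<le> u" "card (sect {} {x, z} F) \<le> u"
    unfolding star_or_cover_def by (auto simp: card_sect_restr insert_commute)
  then show ?thesis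
  proof cases
    case star
    then have "card (sect {} {y} F) \<le> 5 * u"
      using card_sect_split[OF finF, of "{}" "{y}" x] by simp
    then have "card F < 2 * card (sect {y} {} F)"
      using deg[of y] big card by linarith
    then show ?thesis using star by blast
  next
    case cover
    define D where "D = card (sect {x} {} F) + card (sect {y} {} F) + card (sect {z} {} F)"
    have "2 * card F \<le> D + 3 * u"
      using sum_three_degrees[OF finF, of x y z] cover(5-7) unfolding D_def by linarith
    moreover have "6 * u < card F" using big card by linarith
    ultimately have "3 * card F < 2 * D" by linarith
    then have "card F < 2 * card (sect {x} {} F) \<or> card F < 2 * card (sect {y} {} F) \<or>
        card F < 2 * card (sect {z} {} F)" using D_def by linarith
    then show ?thesis using x cover by blast
  qed
qed


text \<open>If one of the two traces with exactly one of \<open>i, j\<close> is small, the other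
  element has large degree, and the balanced case applies. Otherwise both traces have a common star
  \<open>y\<close>, so the pairs \<open>{i, y}\<close> and \<open>{j, y}\<close> lie in many sets
  and few sets miss either pair. If \<open>{i, j}\<close> also lies in many sets, \<open>F\<close>
  is almost a triangle family, and otherwise almost a star at \<open>y\<close>.\<close>

lemma large_degree_of_half_meet:
  assumes pos: "0 < u" and large: "24 * u \<le> card F"
    and ij: "i \<in> V" "j \<in> V" "i \<noteq> j" and half: "2 * card (sect {} {i, j} F) < card F"
  shows "\<exists>y\<in>V. card F < 2 * card (sect {y} {} F)"
proof (rule ccontr)
  assume neg: "\<not> ?thesis"
  then have le_half: "2 * card (sect {y} {} F) \<le> card F" if "y \<in> V" for y
    using that by force
  let ?W = "V - {i, j}"
  have cW: "card ?W = card V - 2" using ij fin by simp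
  have Wu: "card ?W choose (k - 3) \<le> u" "(card ?W - 1) choose (k - 3) \<le> card ?W choose (k - 3)"
    unfolding u cW by (auto intro!: binomial_right_mono)
  let ?u = "card ?W choose (k - 3)"
  let ?A = "restr {i} {j} F" and ?B = "restr {j} {i} F"
  note split = card_split_pair[OF finF, of i j] card_split_pair(2)[OF finF, of j i]
    deg[of i] deg[of j]
  have large_deg: "7 * u < card (sect {x} {} F) \<Longrightarrow> x \<in> V \<Longrightarrow> False" for x
  proof -
    assume "7 * u < card (sect {x} {} F)" "x \<in> V"
    moreover from this have "5 * u < card (sect {} {x} F)"
      using le_half[of x] deg[of x] large pos by linarith
    ultimately show False using large_degree_of_balanced neg by blast
  qed
  show False
  proof (cases "4 * ?u < card ?A \<and> 4 * ?u < card ?B")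
    case False
    then have "card (sect {i} {j} F) \<le> 4 * u \<or> card (sect {j} {i} F) \<le> 4 * u"
      using Wu by (auto simp: card_restr)
    then have "7 * u < card (sect {i} {} F) \<or> 7 * u < card (sect {j} {} F)"
      using split half large pos unfolding insert_commute[of j i "{}"] by linarith
    then show False using large_deg ij by blast
  next
    case True
    have k3: "k - 1 - 2 = k - 3" by simp
    have "?A \<subseteq> ksets ?W (k - 1)" "?B \<subseteq> ksets ?W (k - 1)"
      using restr_subset_ksets[OF fin sub, of "{i}" "{j}"] restr_subset_ksets[OF fin sub, of "{j}" "{i}"]
      by (simp_all add: insert_commute)
    then obtain y where y: "y \<in> ?W" "card (sect {} {y} ?A) \<le> ?u" "card (sect {} {y} ?B) \<le> ?u"
      using cross_common_star[of ?W ?A "k - 1" ?B, unfolded k3] True fin Wu(2)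
        cross_intersecting_restr[OF ci, of "{i}" "{j}"] by (meson finite_Diff order_trans)
    then have y': "card (sect {i} {j, y} F) \<le> ?u" "card (sect {j} {i, y} F) \<le> ?u"
      by (simp_all add: card_sect_restr insert_commute)
    have heavy: "card (sect {} {p, q} F) \<le> u"
      if pq: "p \<in> V" "q \<in> V" "p \<noteq> q" and "2 * ?u < card (sect {p, q} {} F)" for p q
    proof -
      have "card (V - ({p, q} \<union> {})) \<le> card ?W" using pq fin cW by simp
      from cross_sect_1_3[OF fin sub sub ci this, where r = "k - 3" and s = "k - 3"]
      have "card (sect {p, q} {} F) \<le> 2 * ((card ?W - 1) choose (k - 3)) \<or> card (sect {} {p, q} F) \<le> ?u"
        using pq by simp
      then show ?thesis using that(4) Wu by linarith
    qed
    have "2 * ?u < card (sect {i, y} {} F)" "2 * ?u < card (sect {j, y} {} F)"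
    proof -
      have "card (sect {y, i} {j} F) \<le> card (sect {y, i} {} F)" "card (sect {y, j} {i} F) \<le> card (sect {y, j} {} F)"
        by (auto intro!: card_sect_mono[OF finF])
      then show "2 * ?u < card (sect {i, y} {} F)" "2 * ?u < card (sect {j, y} {} F)"
        using True y' card_sect_split[OF finF, of "{i}" "{j}" y] card_sect_split[OF finF, of "{j}" "{i}" y]
        by (auto simp: card_restr insert_commute)
    qed
    then have light: "card (sect {} {i, y} F) \<le> u" "card (sect {} {j, y} F) \<le> u"
      using heavy y ij by auto
    show False
    proof (cases "2 * ?u < card (sect {i, j} {} F)")
      case True
      then have "card (sect {} {i, j} F) \<le> u" using heavy ij by blast
      then show False
        using light y'(1) Wu(1) sum_three_degrees[OF finF, of i j y] le_half[of i] le_half[of j] le_half[of y]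
          ij y large pos by auto
    next
      case False
      have "card (sect {i, j} {y} F) \<le> card (sect {i, j} {} F)"
        by (rule card_sect_mono[OF finF]) auto
      then have "card (sect {} {y} F) \<le> 4 * u"
        using False light y'(1) Wu(1) card_sect_split[OF finF, of "{}" "{y}" i]
          card_sect_split[OF finF, of "{i}" "{y}" j] by (simp add: insert_commute)
      then show False using le_half[of y] y deg[of y] large pos by auto
    qed
  qed
qed

text \<open>A member that does not climb 1, paired with itself, would have to climb 2. So all climb
  1, and those missing the two least elements climb 3 after them: there are at most
  \<open>u\<close>, and more than half of \<open>F\<close> meets that pair.\<close>

lemma large_degree_shifted:
  assumes pos: "0 < u" and large: "24 * u \<le> card F" and sh: "shifted V F"
  shows "\<exists>y\<in>V. card F < 2 * card (sect {y} {} F)"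
proof -
  have FV: "S \<subseteq> V" if "S \<in> F" for S using that sub by (auto simp: ksets_def)
  have climb: "climbs V 1 S" if "S \<in> F" for S
  proof (rule ccontr)
    assume "\<not> climbs V 1 S"
    moreover from this have "climbs V 2 S"
      using climbs_of_not_climbs[OF fin sub sub ci sh that that, of 1] by simp
    ultimately show False using climbs_mono[of V 2 S 1] by simp
  qed
  have "F \<noteq> {}" using pos large by auto
  then obtain S where "S \<subseteq> V" "card S = k" using sub by (auto simp: ksets_def)
  then have cV: "3 \<le> card V" using card_mono[OF fin] k order_trans by blast
  then have "V \<noteq> {}" by auto
  then obtain v where v: "v \<in> V" "\<And>w. w \<in> V \<Longrightarrow> v \<le> w" using exists_least fin by blast
  have "card (V - {v}) \<noteq> 0" using v cV fin by simp
  then have "V - {v} \<noteq> {}" by (metis card.empty)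
  then obtain v' where v': "v' \<in> V - {v}" "\<And>w. w \<in> V - {v} \<Longrightarrow> v' \<le> w"
    using exists_least[of "V - {v}"] fin by blast
  have "climbs (V - ({} \<union> {v, v'})) 3 (S - {})" if "S \<in> sect {} {v, v'} F" for S
  proof -
    have S: "S \<in> F" "S \<subseteq> V" "v \<notin> S" "v' \<notin> S" "S \<subseteq> V - {v}"
      using that FV[of S] by (auto simp: sect_def)
    then have "climbs (V - {v}) (Suc (Suc 0)) S"
      using climb[of S] climbs_least_notin[OF fin v, of S 0] by simp
    then have "climbs (V - {v} - {v'}) 3 S"
      using climbs_least_notin[OF _ v' S(5,4), of "Suc 0"] fin by (simp add: numeral_3_eq_3)
    moreover have "V - {v} - {v'} = V - ({} \<union> {v, v'})" by auto
    ultimately show ?thesis by simp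
  qed
  then have "card (sect {} {v, v'} F) \<le> card (V - ({} \<union> {v, v'})) choose (k - 3)"
    using card_sect_climbs_le[OF fin sub, of "{}" "{v, v'}" 3] by simp
  also have "\<dots> \<le> u"
    unfolding u using v v' fin by (intro binomial_right_mono) auto
  finally have "2 * card (sect {} {v, v'} F) < card F" using large pos by linarith
  then show ?thesis using large_degree_of_half_meet[OF pos large, of v v'] v v' by auto
qed

end

lemma intersecting_large_degree:
  assumes fin: "finite V" and k: "3 \<le> k" and u: "u = (card V - 1) choose (k - 3)"
    and "F \<subseteq> ksets V k" "cross_intersecting F F" and pos: "0 < u" and "24 * u \<le> card F"
  shows "\<exists>y\<in>V. card F < 2 * card (sect {y} {} F)"
proof -
  \<comment> \<open>The induction handles pairs of families; \<open>G = F\<close> specialises it to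
    one.\<close>
  have *: "G = F \<longrightarrow> F \<subseteq> ksets V k \<longrightarrow> cross_intersecting F F \<longrightarrow> 24 * u \<le> card F \<longrightarrow>
      (\<exists>y\<in>V. card F < 2 * card (sect {y} {} F))" if "F \<subseteq> Pow V" "G \<subseteq> Pow V" for F G
    using fin that
  proof (induction rule: shift_induct)
    case (shifted F G)
    then show ?case using large_degree_shifted[OF fin k u _ _ pos] by blast
  next
    case (shift F G i j)
    show ?case
    proof (intro impI)
      assume eq: "G = F" and sub: "F \<subseteq> ksets V k" and ci: "cross_intersecting F F" and large: "24 * u \<le> card F"
      have ij: "i \<in> V" "j \<in> V" "i \<noteq> j" using shift by auto
      have finF: "finite F" using finite_family[OF fin sub] .
      obtain y where y: "y \<in> V" "card F < 2 * card (sect {y} {} (shift i j F))"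
        using shift eq shift_subset_ksets[OF fin sub] cross_intersecting_shift[OF ci ij(3)] large by auto
      have card: "card (sect {y} {} (shift i j F)) = card {S \<in> F. y \<in> shift_set i j F S}"
        using card_shift_filter[where R = "\<lambda>S. y \<in> S"] by (simp add: sect_def)
      show "\<exists>y\<in>V. card F < 2 * card (sect {y} {} F)"
      proof (cases "y = i")
        case False
        then have "card {S \<in> F. y \<in> shift_set i j F S} \<le> card (sect {y} {} F)"
          using finF by (intro card_mono) (auto simp: sect_def shift_set_def split: if_splits)
        then have "card F < 2 * card (sect {y} {} F)" using y card by linarith
        then show ?thesis using y by blast
      next
        case True
        have "card {S \<in> F. i \<in> shift_set i j F S} \<le> card (F - sect {} {i, j} F)"
          using finF by (intro card_mono) (auto simp: sect_def shift_set_def split: if_splits)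
        also have "\<dots> = card F - card (sect {} {i, j} F)"
          using finF by (intro card_Diff_subset) (auto simp: sect_def)
        finally have "2 * card (sect {} {i, j} F) < card F"
          using y card unfolding True by linarith
        then show ?thesis using large_degree_of_half_meet[OF fin k u sub ci pos large ij] by blast
      qed
    qed
  qed
  have "F \<subseteq> Pow V" using assms(4) ksets_subset_Pow by blast
  from *[OF this this] show ?thesis using assms by blast
qed

section \<open>Comparison of binomial coefficients, and uniformity at most 2\<close>

text \<open>With \<open>N = n - 3\<close> and \<open>q = k - 3\<close>: if
  \<open>4 * q \<le> N + 1\<close>, the quotient is a product of two factors of at most 4/3, and
  16/9 < 2. Otherwise \<open>n choose (k - 1)\<close> arises from \<open>N choose q\<close> by
  factors of at most 4, at most 4 and less than 3, against the hypothesis with 48.\<close>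

lemma choose_pred_le_two_mult:
  fixes n k :: nat
  assumes "3 \<le> k" "2 * k \<le> n" and le: "48 * ((n - 3) choose (k - 3)) \<le> n choose (k - 1)"
  shows "(n - 1) choose (k - 3) \<le> 2 * ((n - 3) choose (k - 3))"
proof -
  define q N where "q = k - 3" and "N = n - 3"
  have k: "k = q + 3" and n: "n = N + 3" using assms by (auto simp: q_def N_def)
  have Nq: "2 * q + 3 \<le> N" using assms by (simp add: k n)
  define c where "c = N choose q"
  have "0 < c" using Nq by (simp add: c_def)
  have 1: "(N + 1 - q) * (Suc N choose q) = (N + 1) * c"
    using binomial_absorb_comp[of "Suc N" q] by (simp add: c_def)
  show ?thesis
  proof (cases "4 * q \<le> N + 1")
    case True
    have 2: "(N + 2 - q) * (Suc (Suc N) choose q) = (N + 2) * (Suc N choose q)"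
      using binomial_absorb_comp[of "Suc (Suc N)" q] by simp
    have a: "3 * (N + 2) \<le> 4 * (N + 2 - q)" "3 * (N + 1) \<le> 4 * (N + 1 - q)" using True by auto
    have "9 * (Suc (Suc N) choose q) * ((N + 2) * (N + 1))
        = (3 * (N + 2)) * (3 * (N + 1)) * (Suc (Suc N) choose q)" by algebra
    also have "\<dots> \<le> (4 * (N + 2 - q)) * (4 * (N + 1 - q)) * (Suc (Suc N) choose q)"
      by (rule mult_le_mono1[OF mult_le_mono[OF a]])
    also have "\<dots> = 16 * (N + 1 - q) * ((N + 2 - q) * (Suc (Suc N) choose q))" by algebra
    also have "\<dots> = 16 * (N + 2) * ((N + 1 - q) * (Suc N choose q))" unfolding 2 by algebra
    also have "\<dots> = 16 * c * ((N + 2) * (N + 1))" unfolding 1 by algebra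
    finally have "9 * (Suc (Suc N) choose q) \<le> 16 * c"
      by (simp only: mult_le_cancel2) simp
    then show ?thesis by (simp add: k n c_def)
  next
    case False
    define d X Y where "d = Suc (Suc (Suc N)) choose Suc (Suc q)"
      and "X = Suc (Suc N) choose Suc q" and "Y = Suc N choose q"
    have eqs: "q + 2 = Suc (Suc q)" "q + 1 = Suc q" "N + 3 = Suc (Suc (Suc N))" "N + 2 = Suc (Suc N)"
      by simp_all
    have 2: "(q + 2) * d = (N + 3) * X"
      using binomial_absorption[of "Suc q" "Suc (Suc (Suc N))"] by (simp only: d_def X_def eqs diff_Suc_1)
    have 3: "(q + 1) * X = (N + 2) * Y"
      using binomial_absorption[of q "Suc (Suc N)"] by (simp only: X_def Y_def eqs diff_Suc_1)
    have "(q + 2) * (q + 1) * (N + 1 - q) * d = (q + 1) * (N + 1 - q) * ((q + 2) * d)"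
      by (simp only: ac_simps)
    also have "\<dots> = (N + 3) * (N + 1 - q) * ((q + 1) * X)"
      unfolding 2 by (simp only: ac_simps)
    also have "\<dots> = (N + 3) * (N + 2) * ((N + 1 - q) * Y)"
      unfolding 3 by (simp only: ac_simps)
    also have "\<dots> = ((N + 3) * (N + 2)) * (N + 1) * c"
      unfolding 1[folded Y_def] by (simp only: ac_simps)
    also have "\<dots> < ((4 * (q + 2)) * (4 * (q + 1))) * (3 * (N + 1 - q)) * c"
    proof -
      have "(N + 3) * (N + 2) \<le> (4 * (q + 2)) * (4 * (q + 1))"
        using False by (intro mult_le_mono) auto
      moreover have "N + 1 < 3 * (N + 1 - q)" using Nq by auto
      ultimately have "((N + 3) * (N + 2)) * (N + 1) < ((4 * (q + 2)) * (4 * (q + 1))) * (3 * (N + 1 - q))"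
        by (intro mult_le_less_imp_less) auto
      then show ?thesis using \<open>0 < c\<close> by simp
    qed
    also have "\<dots> = (q + 2) * (q + 1) * (N + 1 - q) * (48 * c)"
      by algebra
    finally have "d < 48 * c" by (simp only: mult_less_cancel1)
    moreover have "k - 1 = Suc (Suc q)" by (simp add: k)
    then have "n choose (k - 1) = d" by (simp only: d_def n eqs)
    ultimately show ?thesis using le by (simp add: k n c_def)
  qed
qed

text \<open>For \<open>k \<le> 2\<close> the convention makes \<open>binom_int\<close> zero, so size
  gives no information. Every member meets a fixed \<open>{x, y}\<close> in \<open>F\<close>, which
  is itself counted in both degrees; \<open>x = y\<close> if \<open>k = 1\<close>.\<close>

lemma intersecting_small_uniform:
  assumes "finite V" "F \<noteq> {}" "F \<subseteq> ksets V k" "cross_intersecting F F" "k \<le> 2"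
  shows "\<exists>y\<in>V. card F < 2 * card (sect {y} {} F)"
proof -
  have finF: "finite F" using finite_family assms by blast
  obtain S where S: "S \<in> F" using assms by auto
  have SV: "S \<subseteq> V" "card S = k" "S \<noteq> {}"
    using assms S by (auto simp: ksets_def cross_intersecting_def)
  then have "k \<noteq> 0" using finite_subset[OF SV(1) assms(1)] by auto
  obtain x y where xy: "S = {x, y}"
  proof (cases "k = 2")
    case True
    then show ?thesis using SV that by (auto simp: card_2_iff)
  next
    case False
    then have "card S = 1" using SV \<open>k \<noteq> 0\<close> assms by auto
    then obtain x where "S = {x}" by (rule card_1_singletonE)
    then show ?thesis using that[of x x] by simp
  qed
  have "F \<subseteq> sect {x} {} F \<union> sect {y} {} F"
    using assms(4) S xy by (auto simp: cross_intersecting_def sect_def)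
  then have "card F \<le> card (sect {x} {} F \<union> sect {y} {} F)"
    using finF by (intro card_mono) (auto simp: sect_def)
  moreover have "S \<in> sect {x} {} F \<inter> sect {y} {} F" using S xy by (auto simp: sect_def)
  then have "0 < card (sect {x} {} F \<inter> sect {y} {} F)"
    using finF by (subst card_gt_0_iff) (auto simp: sect_def)
  moreover have "card (sect {x} {} F) + card (sect {y} {} F) =
      card (sect {x} {} F \<union> sect {y} {} F) + card (sect {x} {} F \<inter> sect {y} {} F)"
    using finF by (intro card_Un_Int) (auto simp: sect_def)
  ultimately have "card F < 2 * card (sect {x} {} F) \<or> card F < 2 * card (sect {y} {} F)"
    by linarith
  then show ?thesis using SV xy by auto
qed

theorem mainTheorem2:
  fixes n k :: nat and F :: "nat set set"
  assumes "n \<ge> 2 * k"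
    and "F \<subseteq> {A. A \<subseteq> {1..n} \<and> card A = k}"
    and "F \<noteq> {}"
    and "intersecting F"
    and "real (card F) \<ge> 48 * real (binom_int (int n - 3) (int k - 3))"
  shows "rho n F > 1 / 2"
proof -
  let ?V = "{1..n}"
  have sub: "F \<subseteq> ksets ?V k" using assms(2) by (simp add: ksets_def)
  have ci: "cross_intersecting F F" using assms(4) by (simp add: intersecting_def cross_intersecting_def)
  have finF: "finite F" using finite_family[OF _ sub] by simp
  have "\<exists>y\<in>?V. card F < 2 * card (sect {y} {} F)"
  proof (cases "k \<le> 2")
    case True
    then show ?thesis using intersecting_small_uniform[OF _ assms(3) sub ci] by simp
  next
    case False
    then have k: "3 \<le> k" by simp
    define h u where "h = (n - 3) choose (k - 3)" and "u = (card ?V - 1) choose (k - 3)"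
    have "binom_int (int n - 3) (int k - 3) = h"
      using k assms(1) by (simp add: binom_int_def h_def nat_diff_distrib)
    then have large: "48 * h \<le> card F" using assms(5) by linarith
    have "card F \<le> n choose (k - 1)"
      using cross_card_1_1[OF _ sub sub ci] by simp
    then have "u \<le> 2 * h"
      using choose_pred_le_two_mult[OF k assms(1)] large by (simp add: h_def u_def)
    then have "24 * u \<le> card F" using large by linarith
    moreover have "0 < u" using k assms(1) by (simp add: u_def)
    ultimately show ?thesis
      using intersecting_large_degree[OF _ k u_def sub ci] by simp
  qed
  then obtain y where y: "y \<in> ?V" "card F < 2 * card (sect {y} {} F)" by blast
  have "link F y = restr {y} {} F"
    by (auto simp: link_def restr_def sect_def)
  then have "1 / 2 < real (card (link F y)) / real (card F)"
    using y(2) assms(3) finF by (simp add: card_restr card_gt_0_iff field_simps)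
  also have "\<dots> \<le> rho n F"
    unfolding rho_def using y(1) by (intro Max_ge) auto
  finally show ?thesis .
qed

end
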